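(* There is a randomized algorithm that, given a PL+C model (utilities $u_i$ and consideration probabilities $p_i$ for all $i\in\mathcal U$, with $|\mathcal U|=n$ and ranking length $k$), a length-$k$ ranking $r$, an error tolerance $\epsilon>0$ and a failure probability $\delta\in(0,1)$, outputs an estimate $\hat R$ such that, with probability at least $1-\delta$, both $|\hat R-\Pr_{PLC}(r)|<\epsilon$ and the running time is $O\!\left(kn\log(1/\delta)/(z_{k,p}\epsilon^2)\right)$.
   Context: PL+C model: universe $\mathcal U=\{1,\dots,n\}$, fixed ranking length $k\le n$. Each item $i$ has a utility $u_i$ and a consideration probability $p_i\in(0,1]$. $z_{k,p}=\sum_{C\subseteq\mathcal U,|C|\ge k}\prod_{h\in C}p_h\prod_{h\notin C}(1-p_h)$ is the probability that a random set including each item independently with probability $p_h$ has size at least $k$. A consideration set $C$ is drawn from this distribution conditioned on $|C|\ge k$, i.e. $\Pr_C(C)=\frac{1}{z_{k,p}}\prod_{h\in C}p_h\prod_{h\notin C}(1-p_h)$ for $|C|\ge k$ and $0$ otherwise. Given $C$, $\Pr_{PL}(r\mid C)=\prod_{t=1}^k \frac{\exp(u_{r_t})}{\sum_{h\in C\setminus\{r_1,\dots,r_{t-1}\}}\exp(u_h)}$ if all $r_t\in C$, else $0$, and $\Pr_{PLC}(r)=\sum_C\Pr_C(C)\Pr_{PL}(r\mid C)$. Arithmetic operations and sampling a Bernoulli variable are unit cost.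
   Formalization: The running time bound is proved as c·(1 + kn(1+log(1/δ))/(z ε²)) with one absolute constant c, since the literal expression falls below one step as δ→1, ε→∞ or k=0; for δ ≤ 1/2, ε ≤ 1, k ≥ 1 this is the stated bound up to a constant. *)

theory Defs
  imports "HOL-Probability.Probability"
begin

definition cs_weight :: "nat \<Rightarrow> (nat \<Rightarrow> real) \<Rightarrow> nat set \<Rightarrow> real" where
  "cs_weight n p C = (\<Prod>h\<in>C. p h) * (\<Prod>h\<in>{1..n} - C. 1 - p h)"

definition z_kp :: "nat \<Rightarrow> nat \<Rightarrow> (nat \<Rightarrow> real) \<Rightarrow> real" where
  "z_kp n k p = (\<Sum>C\<in>{C. C \<subseteq> {1..n} \<and> k \<le> card C}. cs_weight n p C)"

definition Pr_C :: "nat \<Rightarrow> nat \<Rightarrow> (nat \<Rightarrow> real) \<Rightarrow> nat set \<Rightarrow> real" where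
  "Pr_C n k p C = (if C \<subseteq> {1..n} \<and> k \<le> card C then cs_weight n p C / z_kp n k p else 0)"

definition Pr_PL :: "(nat \<Rightarrow> real) \<Rightarrow> nat list \<Rightarrow> nat set \<Rightarrow> real" where
  "Pr_PL u r C = (if set r \<subseteq> C then
      (\<Prod>t<length r. exp (u (r ! t)) / (\<Sum>h\<in>C - set (take t r). exp (u h)))
    else 0)"

definition Pr_PLC :: "nat \<Rightarrow> nat \<Rightarrow> (nat \<Rightarrow> real) \<Rightarrow> (nat \<Rightarrow> real) \<Rightarrow> nat list \<Rightarrow> real" where
  "Pr_PLC n k u p r = (\<Sum>C\<in>Pow {1..n}. Pr_C n k p C * Pr_PL u r C)"

text \<open>Integer memory (used for indices, counters, indirect addressing) and real memory.
  Every instruction (arithmetic, comparison/jump, memory access, Bernoulli sample) costs one step.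
  There is no real-to-integer conversion (no floor), constants are integers.\<close>

datatype instr =
    IConst nat int
  | IAdd nat nat nat
  | ISub nat nat nat
  | ILoad nat nat
  | IStore nat nat
  | RConst nat int
  | RAdd nat nat nat
  | RSub nat nat nat
  | RMul nat nat nat
  | RDiv nat nat nat
  | RExp nat nat
  | RLn nat nat
  | ROfInt nat nat
  | RLoad nat nat
  | RStore nat nat
  | JLeI nat nat nat
  | JLtR nat nat nat
  | Jmp nat
  | Bern nat nat            (* imem a := 1 with probability rmem b (clamped to [0,1]), else 0 *)
  | Halt

record mstate =
  pc :: nat
  imem :: "nat \<Rightarrow> int"
  rmem :: "nat \<Rightarrow> real"

definition setI :: "nat \<Rightarrow> int \<Rightarrow> mstate \<Rightarrow> mstate" where
  "setI a v s = s\<lparr>imem := (imem s)(a := v), pc := Suc (pc s)\<rparr>"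

definition setR :: "nat \<Rightarrow> real \<Rightarrow> mstate \<Rightarrow> mstate" where
  "setR a v s = s\<lparr>rmem := (rmem s)(a := v), pc := Suc (pc s)\<rparr>"

definition next_pc :: "mstate \<Rightarrow> mstate" where
  "next_pc s = s\<lparr>pc := Suc (pc s)\<rparr>"

fun exec :: "instr \<Rightarrow> mstate \<Rightarrow> mstate pmf" where
  "exec (IConst a c) s = return_pmf (setI a c s)"
| "exec (IAdd a b c) s = return_pmf (setI a (imem s b + imem s c) s)"
| "exec (ISub a b c) s = return_pmf (setI a (imem s b - imem s c) s)"
| "exec (ILoad a b) s = return_pmf (setI a (imem s (nat (imem s b))) s)"
| "exec (IStore a b) s = return_pmf (setI (nat (imem s a)) (imem s b) s)"
| "exec (RConst a c) s = return_pmf (setR a (of_int c) s)"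
| "exec (RAdd a b c) s = return_pmf (setR a (rmem s b + rmem s c) s)"
| "exec (RSub a b c) s = return_pmf (setR a (rmem s b - rmem s c) s)"
| "exec (RMul a b c) s = return_pmf (setR a (rmem s b * rmem s c) s)"
| "exec (RDiv a b c) s = return_pmf (setR a (rmem s b / rmem s c) s)"
| "exec (RExp a b) s = return_pmf (setR a (exp (rmem s b)) s)"
| "exec (RLn a b) s = return_pmf (setR a (ln (rmem s b)) s)"
| "exec (ROfInt a b) s = return_pmf (setR a (of_int (imem s b)) s)"
| "exec (RLoad a b) s = return_pmf (setR a (rmem s (nat (imem s b))) s)"
| "exec (RStore a b) s = return_pmf (setR (nat (imem s a)) (rmem s b) s)"
| "exec (JLeI a b t) s = return_pmf (if imem s a \<le> imem s b then s\<lparr>pc := t\<rparr> else next_pc s)"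
| "exec (JLtR a b t) s = return_pmf (if rmem s a < rmem s b then s\<lparr>pc := t\<rparr> else next_pc s)"
| "exec (Jmp t) s = return_pmf (s\<lparr>pc := t\<rparr>)"
| "exec (Bern a b) s = map_pmf (\<lambda>x. setI a (if x then 1 else 0) s) (bernoulli_pmf (rmem s b))"
| "exec Halt s = return_pmf s"

type_synonym program = "instr list"

definition halted :: "program \<Rightarrow> mstate \<Rightarrow> bool" where
  "halted P s \<longleftrightarrow> length P \<le> pc s \<or> P ! pc s = Halt"

definition step :: "program \<Rightarrow> mstate \<Rightarrow> mstate pmf" where
  "step P s = (if halted P s then return_pmf s else exec (P ! pc s) s)"

text \<open>Distribution of the machine state after T steps (halted states are absorbing,
  so being halted after T steps means halting within running time T).\<close>
definition run :: "program \<Rightarrow> nat \<Rightarrow> mstate \<Rightarrow> mstate pmf" where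
  "run P T s0 = ((\<lambda>D. bind_pmf D (step P)) ^^ T) (return_pmf s0)"

text \<open>Input encoding: imem 0 = n, imem 1 = k, imem (2+t) = r!t (t<k);
  rmem 0 = epsilon, rmem 1 = delta, rmem (2i) = u i, rmem (2i+1) = p i (1 \<le> i \<le> n);
  all other cells 0. The out_val is rmem 0 at halting.\<close>
definition init_state :: "nat \<Rightarrow> nat \<Rightarrow> (nat \<Rightarrow> real) \<Rightarrow> (nat \<Rightarrow> real) \<Rightarrow> nat list
    \<Rightarrow> real \<Rightarrow> real \<Rightarrow> mstate" where
  "init_state n k u p r eps del =
     \<lparr> pc = 0,
       imem = (\<lambda>j. if j = 0 then int n else if j = 1 then int k
                   else if j - 2 < length r then int (r ! (j - 2)) else 0),
       rmem = (\<lambda>j. if j = 0 then eps else if j = 1 then del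
                   else if 1 \<le> j div 2 \<and> j div 2 \<le> n then
                     (if even j then u (j div 2) else p (j div 2))
                   else 0) \<rparr>"

definition out_val :: "mstate \<Rightarrow> real" where
  "out_val s = rmem s 0"

end

theory Submission
  imports Defs
begin

text \<open>
  Instead of sampling consideration sets by rejection, sample only the items outside the ranking:
  let \<open>A\<close> contain each unranked item \<open>i\<close> independently with probability \<open>p i\<close>, and let
  \<open>X = Pr_PL u r (A \<union> set r)\<close>. As only sets containing \<open>r\<close> contribute, and these have size at least
  \<open>k\<close>, we get \<open>Pr_PLC = q / z * E X\<close>, where \<open>q\<close> is the product of the \<open>p i\<close> over the ranked
  items and \<open>z = z_kp n k p\<close>. Since \<open>q \<le> z\<close>, the mean of \<open>m \<ge> ln (2 / del) / (2 * eps\<^sup>2)\<close>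
  samples of \<open>X\<close>, scaled by \<open>q / z\<close>, is accurate by Hoeffding's inequality. The normaliser \<open>z\<close> is
  computed exactly in \<open>O(k n)\<close> steps by the recursion for the tails of a sum of independent
  Bernoulli variables, so the running time does not depend on the random choices.
\<close>

section \<open>Consideration sets\<close>

text \<open>For probabilities in [0,1] this is the expectation of \<open>h\<close> under the
  unconditioned product distribution. Conditioning on size at least \<open>k\<close> only enters
  later, as a division by \<open>z_kp\<close>.\<close>

definition cs_expect :: "nat \<Rightarrow> (nat \<Rightarrow> real) \<Rightarrow> (nat set \<Rightarrow> real) \<Rightarrow> real" where
  "cs_expect n p h = (\<Sum>C\<in>Pow {1..n}. cs_weight n p C * h C)"

lemma cs_expect_0 [simp]: "cs_expect 0 p h = h {}"
  by (simp add: cs_expect_def cs_weight_def)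

text \<open>Conditioning on whether the last item is considered. The exact expectations below are
  obtained by induction with this recursion.\<close>

lemma cs_expect_Suc:
  "cs_expect (Suc n) p h =
     (1 - p (Suc n)) * cs_expect n p h + p (Suc n) * cs_expect n p (\<lambda>C. h (insert (Suc n) C))"
proof -
  have notin: "cs_weight (Suc n) p C = (1 - p (Suc n)) * cs_weight n p C" if "C \<in> Pow {1..n}" for C
  proof -
    have "{1..Suc n} - C = insert (Suc n) ({1..n} - C)" using that
        by (auto simp: atLeastAtMostSuc_conv)
    then show ?thesis by (simp add: cs_weight_def)
  qed
  have ins: "cs_weight (Suc n) p (insert (Suc n) C) = p (Suc n) * cs_weight n p C"
      if "C \<in> Pow {1..n}" for C
  proof -
    have "{1..Suc n} - insert (Suc n) C = {1..n} - C" by (auto simp: atLeastAtMostSuc_conv)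
    moreover have "finite C" "Suc n \<notin> C" using that by (auto intro: finite_subset)
    ultimately show ?thesis by (simp add: cs_weight_def)
  qed
  have inj: "inj_on (insert (Suc n)) (Pow {1..n})"
    by (rule inj_onI) (metis Diff_insert_absorb PowD Suc_n_not_le_n atLeastAtMost_iff subsetD)
  have "Pow {1..Suc n} = Pow {1..n} \<union> insert (Suc n) ` Pow {1..n}"
    by (simp add: atLeastAtMostSuc_conv Pow_insert)
  moreover have "Pow {1..n} \<inter> insert (Suc n) ` Pow {1..n} = {}" by auto
  moreover have "(\<Sum>C\<in>insert (Suc n) ` Pow {1..n}. cs_weight (Suc n) p C * h C) =
      (\<Sum>C\<in>Pow {1..n}. cs_weight (Suc n) p (insert (Suc n) C) * h (insert (Suc n) C))"
    by (subst sum.reindex[OF inj]) simp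
  ultimately have "cs_expect (Suc n) p h = (\<Sum>C\<in>Pow {1..n}. cs_weight (Suc n) p C * h C) +
      (\<Sum>C\<in>Pow {1..n}. cs_weight (Suc n) p (insert (Suc n) C) * h (insert (Suc n) C))"
    by (simp add: cs_expect_def sum.union_disjoint)
  moreover have "(\<Sum>C\<in>Pow {1..n}. cs_weight (Suc n) p C * h C) = (1 - p (Suc n)) * cs_expect n p h"
    unfolding cs_expect_def sum_distrib_left by (rule sum.cong[OF refl]) (simp add: notin
        mult.assoc)
  moreover have "(\<Sum>C\<in>Pow {1..n}. cs_weight (Suc n) p (insert (Suc n) C) * h (insert (Suc n) C)) =
      p (Suc n) * cs_expect n p (\<lambda>C. h (insert (Suc n) C))"
    unfolding cs_expect_def sum_distrib_left by (rule sum.cong[OF refl]) (simp add: ins mult.assoc)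
  ultimately show ?thesis by simp
qed

lemma cs_expect_cong:
  "(\<And>C. C \<subseteq> {1..n} \<Longrightarrow> h C = h' C) \<Longrightarrow> cs_expect n p h = cs_expect n p h'"
  unfolding cs_expect_def by (rule sum.cong) auto

lemma cs_expect_0_fun: "cs_expect n p (\<lambda>_. 0) = 0"
  by (simp add: cs_expect_def)

lemma cs_expect_mono:
  assumes "\<And>i. i \<in> {1..n} \<Longrightarrow> 0 \<le> p i \<and> p i \<le> 1" "\<And>C. C \<subseteq> {1..n} \<Longrightarrow> h C \<le> h' C"
  shows "cs_expect n p h \<le> cs_expect n p h'"
proof -
  have "0 \<le> cs_weight n p C" if "C \<subseteq> {1..n}" for C
    unfolding cs_weight_def using assms(1) that by (intro mult_nonneg_nonneg prod_nonneg) auto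
  with assms(2) show ?thesis by (auto simp: cs_expect_def intro!: sum_mono mult_left_mono)
qed

lemma cs_expect_1: "cs_expect n p (\<lambda>_. 1) = 1"
  by (induction n) (simp_all add: cs_expect_Suc)

lemma z_kp_eq_cs_expect: "z_kp n k p = cs_expect n p (\<lambda>C. if k \<le> card C then 1 else 0)"
proof -
  have "{C. C \<subseteq> {1..n} \<and> k \<le> card C} = {C \<in> Pow {1..n}. k \<le> card C}" by auto
  then have "z_kp n k p = (\<Sum>C\<in>Pow {1..n}. if k \<le> card C then cs_weight n p C else 0)"
    unfolding z_kp_def by (simp only:) (rule sum.inter_filter, simp)
  then show ?thesis
    by (simp add: cs_expect_def if_distrib cong: if_cong)
qed

lemma z_kp_zero: "z_kp n 0 p = 1"
  by (simp add: z_kp_eq_cs_expect cs_expect_1)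

lemma z_kp_0_Suc: "z_kp 0 (Suc j) p = 0"
  by (simp add: z_kp_eq_cs_expect)

text \<open>Condition on the last item: if it is present, only \<open>j\<close> further items are
  needed. The right-hand side is arranged with a single multiplication, exactly as the program
  evaluates it.\<close>

lemma z_kp_Suc_Suc:
  "z_kp (Suc n) (Suc j) p = z_kp n (Suc j) p + (z_kp n j p - z_kp n (Suc j) p) * p (Suc n)"
proof -
  have "cs_expect n p (\<lambda>C. if Suc j \<le> card (insert (Suc n) C) then 1 else 0) = z_kp n j p"
    unfolding z_kp_eq_cs_expect
  proof (rule cs_expect_cong)
    fix C assume "C \<subseteq> {1..n}"
    then have "finite C" "Suc n \<notin> C" by (auto intro: finite_subset)
    then show "(if Suc j \<le> card (insert (Suc n) C) then 1 else 0) =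
        (if j \<le> card C then 1 else 0 :: real)"
      by simp
  qed
  then show ?thesis
    by (simp add: z_kp_eq_cs_expect[of "Suc n"] cs_expect_Suc) (simp add: z_kp_eq_cs_expect
        algebra_simps)
qed

text \<open>Each item of \<open>R\<close> has to be present, which pulls out the factor
  \<open>p i\<close>; afterwards it is adjoined deterministically, so \<open>p'\<close> makes it
  absent from the random set. \<open>h\<close> is generalised because the induction absorbs an
  inserted item into it.\<close>

lemma cs_expect_superset:
  assumes "\<And>i. i \<in> R \<Longrightarrow> p' i = 0" "\<And>i. i \<notin> R \<Longrightarrow> p' i = p i"
  shows "cs_expect n p (\<lambda>C. if R \<inter> {1..n} \<subseteq> C then h C else 0) =
     (\<Prod>i\<in>R \<inter> {1..n}. p i) * cs_expect n p' (\<lambda>A. h (A \<union> R \<inter> {1..n}))"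
proof (induction n arbitrary: h)
  case 0
  then show ?case by simp
next
  case (Suc n)
  show ?case
  proof (cases "Suc n \<in> R")
    case True
    then have R: "R \<inter> {1..Suc n} = insert (Suc n) (R \<inter> {1..n})"
        by (auto simp: atLeastAtMostSuc_conv)
    \<comment> \<open>The branch without \<open>Suc n\<close> vanishes: no subset of
      \<open>{1..n}\<close> contains that item.\<close>
    have "cs_expect n p (\<lambda>C. if insert (Suc n) (R \<inter> {1..n}) \<subseteq> C then h C else 0) =
        cs_expect n p (\<lambda>_. 0)"
      by (rule cs_expect_cong) auto
    moreover have "cs_expect n p (\<lambda>C. if insert (Suc n) (R \<inter> {1..n}) \<subseteq> insert (Suc n) C then h
        (insert (Suc n) C) else 0)
       = cs_expect n p (\<lambda>C. if R \<inter> {1..n} \<subseteq> C then h (insert (Suc n) C) else 0)"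
      by (rule cs_expect_cong) auto
    ultimately show ?thesis
      using assms(1)[OF True] Suc.IH[of "\<lambda>C. h (insert (Suc n) C)"]
      unfolding R by (simp add: cs_expect_Suc cs_expect_0_fun)
  next
    case False
    then have R: "R \<inter> {1..Suc n} = R \<inter> {1..n}" by (auto simp: atLeastAtMostSuc_conv)
    have "cs_expect n p (\<lambda>C. if R \<inter> {1..n} \<subseteq> insert (Suc n) C then h (insert (Suc n) C) else 0)
       = cs_expect n p (\<lambda>C. if R \<inter> {1..n} \<subseteq> C then h (insert (Suc n) C) else 0)"
      by (rule cs_expect_cong) auto
    then show ?thesis
      using assms(2)[OF False] Suc.IH[of h] Suc.IH[of "\<lambda>C. h (insert (Suc n) C)"]
      unfolding R by (simp add: cs_expect_Suc algebra_simps)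
  qed
qed

section \<open>The total weight of a random set\<close>

primrec subset_sum_pmf :: "(nat \<Rightarrow> real) \<Rightarrow> (nat \<Rightarrow> real) \<Rightarrow> nat \<Rightarrow> real pmf" where
  "subset_sum_pmf p e 0 = return_pmf 0"
| "subset_sum_pmf p e (Suc i) = subset_sum_pmf p e i \<bind>
     (\<lambda>w. map_pmf (\<lambda>b. w + (if b then e (Suc i) else 0)) (bernoulli_pmf (p (Suc i))))"

lemma expectation_bind_finite:
  fixes h :: "'b \<Rightarrow> real"
  assumes "finite (set_pmf p)" "\<And>x. x \<in> set_pmf p \<Longrightarrow> finite (set_pmf (f x))"
  shows "measure_pmf.expectation (p \<bind> f) h =
     measure_pmf.expectation p (\<lambda>x. measure_pmf.expectation (f x) h)"
  using assms pmf_expectation_bind[of "set_pmf p" f p h]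
  by (simp add: integral_measure_pmf[of "set_pmf p"])

lemma finite_subset_sum_pmf: "finite (set_pmf (subset_sum_pmf p e n))"
  by (induction n) (simp_all add: finite_subset[OF subset_UNIV])

lemma subset_sum_pmf_nonneg:
  "(\<And>i. 0 \<le> e i) \<Longrightarrow> w \<in> set_pmf (subset_sum_pmf p e n) \<Longrightarrow> 0 \<le> w"
  by (induction n arbitrary: w) auto

text \<open>Both sides satisfy the same recursion on the last item. Tracking the sum instead of the
  set suffices, since the Plackett-Luce product depends on the unranked items only through their
  total weight; this is also all that the program stores.\<close>

lemma expectation_subset_sum_pmf:
  assumes "\<And>i. i \<in> {1..n} \<Longrightarrow> 0 \<le> p i \<and> p i \<le> 1"
  shows "measure_pmf.expectation (subset_sum_pmf p e n) h = cs_expect n p (\<lambda>C. h (sum e C))"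
  using assms
proof (induction n arbitrary: h)
  case 0
  then show ?case by simp
next
  case (Suc n)
  have p: "0 \<le> p (Suc n)" "p (Suc n) \<le> 1" using Suc.prems by auto
  have IH: "measure_pmf.expectation (subset_sum_pmf p e n) h =
      cs_expect n p (\<lambda>C. h (sum e C))" for h
    using Suc by simp
  have "measure_pmf.expectation (subset_sum_pmf p e (Suc n)) h =
      measure_pmf.expectation (subset_sum_pmf p e n)
       (\<lambda>w. p (Suc n) * h (w + e (Suc n)) + (1 - p (Suc n)) * h w)"
    using p by (simp add: expectation_bind_finite finite_subset_sum_pmf finite_subset[OF
        subset_UNIV] mult.commute)
  also have "\<dots> = p (Suc n) * cs_expect n p (\<lambda>C. h (sum e C + e (Suc n))) +
      (1 - p (Suc n)) * cs_expect n p (\<lambda>C. h (sum e C))"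
    unfolding IH by (simp add: cs_expect_def sum.distrib sum_distrib_left distrib_left
        mult.left_commute)
  also have "cs_expect n p (\<lambda>C. h (sum e C + e (Suc n))) =
      cs_expect n p (\<lambda>C. h (sum e (insert (Suc n) C)))"
  proof (rule cs_expect_cong)
    fix C assume "C \<subseteq> {1..n}"
    then have "finite C" "Suc n \<notin> C" by (auto intro: finite_subset)
    then show "h (sum e C + e (Suc n)) = h (sum e (insert (Suc n) C))" by (simp add: add.commute)
  qed
  finally show ?case by (simp add: cs_expect_Suc)
qed

section \<open>Hoeffding's inequality for sums of independent samples\<close>

text \<open>Independence is expressed by iterated binding, which mirrors a loop adding fresh samples
  to an accumulator and needs no product space.\<close>

primrec iid_sum_pmf :: "real pmf \<Rightarrow> nat \<Rightarrow> real pmf" where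
  "iid_sum_pmf X 0 = return_pmf 0"
| "iid_sum_pmf X (Suc m) = iid_sum_pmf X m \<bind> (\<lambda>s. map_pmf (\<lambda>x. s + x) X)"

lemma finite_iid_sum_pmf: "finite (set_pmf X) \<Longrightarrow> finite (set_pmf (iid_sum_pmf X m))"
  by (induction m) auto

lemma iid_sum_pmf_uminus: "iid_sum_pmf (map_pmf uminus X) m = map_pmf uminus (iid_sum_pmf X m)"
  by (induction m) (simp_all add: map_bind_pmf bind_map_pmf pmf.map_comp o_def)

lemma expectation_exp_iid_sum:
  assumes "finite (set_pmf X)"
  shows "measure_pmf.expectation (iid_sum_pmf X m) (\<lambda>s. exp (l * s)) =
      measure_pmf.expectation X (\<lambda>x. exp (l * x)) ^ m"
  using assms
  by (induction m) (simp_all add: expectation_bind_finite finite_iid_sum_pmf exp_add distrib_left)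

text \<open>The Chernoff method: Hoeffding's lemma bounds the exponential moment of one sample,
  independence turns it into an \<open>m\<close>-th power, and Markov's inequality finishes. The
  interval may start at any \<open>a\<close> so that the bound also applies to the negated
  samples.\<close>

lemma Hoeffding_iid_sum_ge:
  assumes fin: "finite (set_pmf X)" and range: "set_pmf X \<subseteq> {a..a + 1}" and "0 < t"
  defines "\<mu> \<equiv> measure_pmf.expectation X (\<lambda>x. x)"
  shows "measure_pmf.prob (iid_sum_pmf X m) {s. real m * (\<mu> + t) \<le> s} \<le> exp (- 2 * real m * t\<^sup>2)"
proof -
  \<comment> \<open>This value minimises the exponent \<open>l\<^sup>2 / 8 - l * t\<close>, giving
    \<open>- 2 * t\<^sup>2\<close>.\<close>
  define l where "l = 4 * t"
  interpret X: interval_bounded_random_variable "measure_pmf X" "\<lambda>x. x" a "a + 1"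
    by unfold_locales (use range in \<open>auto simp: AE_measure_pmf_iff\<close>)
  have "ennreal (measure_pmf.expectation X (\<lambda>x. exp (l * (x - \<mu>)))) \<le>
      ennreal (exp (l\<^sup>2 * (a + 1 - a)\<^sup>2 / 8))"
    using X.Hoeffdings_lemma_nn_integral[of l] \<open>0 < t\<close>
    by (subst nn_integral_eq_integral[symmetric])
       (auto simp: l_def \<mu>_def integrable_measure_pmf_finite[OF fin])
  then have "measure_pmf.expectation X (\<lambda>x. exp (l * (x - \<mu>))) \<le> exp (l\<^sup>2 / 8)" by simp
  moreover have "measure_pmf.expectation X (\<lambda>x. exp (l * (x - \<mu>))) =
      measure_pmf.expectation X (\<lambda>x. exp (l * x)) * exp (- l * \<mu>)"
    by (simp add: exp_diff exp_minus right_diff_distrib divide_inverse)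
  ultimately have "measure_pmf.expectation X (\<lambda>x. exp (l * x)) * exp (- l * \<mu>) * exp (l * \<mu>) \<le>
      exp (l\<^sup>2 / 8) * exp (l * \<mu>)"
    by (intro mult_right_mono) simp_all
  then have mgf: "measure_pmf.expectation X (\<lambda>x. exp (l * x)) \<le> exp (l * \<mu> + l\<^sup>2 / 8)"
    unfolding mult.assoc exp_add[symmetric] by (simp add: add.commute)
  let ?S = "iid_sum_pmf X m" and ?c = "real m * (\<mu> + t)"
  have int: "integrable ?S f" for f :: "real \<Rightarrow> real"
    by (rule integrable_measure_pmf_finite[OF finite_iid_sum_pmf[OF fin]])
  have "measure_pmf.prob ?S {s. ?c \<le> s} = measure_pmf.expectation ?S (indicator {s. ?c \<le>
      s})" by simp
  \<comment> \<open>Markov's inequality, in the form that the indicator lies below the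
    exponential.\<close>
  also have "\<dots> \<le> measure_pmf.expectation ?S (\<lambda>s. exp (l * s) * exp (- l * ?c))"
  proof (rule integral_mono[OF int int])
    fix s
    have "1 \<le> exp (l * s + - l * ?c)" if "?c \<le> s"
      using mult_left_mono[OF that, of l] \<open>0 < t\<close> by (simp add: l_def)
    then show "indicator {s. ?c \<le> s} s \<le> exp (l * s) * exp (- l * ?c)"
      unfolding exp_add[symmetric] by (auto simp: indicator_def)
  qed
  also have "\<dots> = measure_pmf.expectation X (\<lambda>x. exp (l * x)) ^ m * exp (- l * ?c)"
    by (simp add: expectation_exp_iid_sum[OF fin])
  also have "\<dots> \<le> exp (l * \<mu> + l\<^sup>2 / 8) ^ m * exp (- l * ?c)"
    by (intro mult_right_mono power_mono mgf) auto
  also have "\<dots> = exp (- 2 * real m * t\<^sup>2)"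
    by (simp add: exp_of_nat_mult[symmetric] exp_add[symmetric] l_def power2_eq_square
        algebra_simps)
  finally show ?thesis .
qed

text \<open>Union bound over the upper tail of the samples and the upper tail of their negations,
  which lie in \<open>{-1..0}\<close>.\<close>

lemma Hoeffding_iid_sum:
  assumes fin: "finite (set_pmf X)" and range: "set_pmf X \<subseteq> {0..1}" and "0 < t"
  defines "\<mu> \<equiv> measure_pmf.expectation X (\<lambda>x. x)"
  shows "measure_pmf.prob (iid_sum_pmf X m) {s. \<bar>s - real m * \<mu>\<bar> < real m * t} \<ge> 1 - 2 *
      exp (- 2 * real m * t\<^sup>2)"
proof -
  let ?S = "iid_sum_pmf X m"
  have up: "measure_pmf.prob ?S {s. real m * (\<mu> + t) \<le> s} \<le> exp (- 2 * real m * t\<^sup>2)"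
    unfolding \<mu>_def by (rule Hoeffding_iid_sum_ge[OF fin, of 0]) (use range \<open>0 < t\<close> in auto)
  have "measure_pmf.prob (iid_sum_pmf (map_pmf uminus X) m)
      {s. real m * (measure_pmf.expectation (map_pmf uminus X) (\<lambda>x. x) + t) \<le> s} \<le>
          exp (- 2 * real m * t\<^sup>2)"
    by (rule Hoeffding_iid_sum_ge[of _ "-1"]) (use fin range \<open>0 < t\<close> in auto)
  then have lo: "measure_pmf.prob ?S {s. real m * (- \<mu> + t) \<le> - s} \<le> exp (- 2 * real m * t\<^sup>2)"
    by (simp add: iid_sum_pmf_uminus \<mu>_def vimage_def)
  have "{s. \<bar>s - real m * \<mu>\<bar> < real m * t} = UNIV - ({s. real m * (\<mu> + t) \<le>
      s} \<union> {s. real m * (- \<mu> + t) \<le> - s})"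
    by (auto simp: algebra_simps abs_less_iff)
  then have "measure_pmf.prob ?S {s. \<bar>s - real m * \<mu>\<bar> < real m * t} =
     1 - measure_pmf.prob ?S ({s. real m * (\<mu> + t) \<le> s} \<union> {s. real m * (- \<mu> + t) \<le> - s})"
    using measure_pmf.prob_compl[of "{s. real m * (\<mu> + t) \<le> s} \<union> {s. real m * (- \<mu> + t) \<le>
        - s}" ?S] by simp
  also have "\<dots> \<ge> 1 - (exp (- 2 * real m * t\<^sup>2) + exp (- 2 * real m * t\<^sup>2))"
    using measure_Un_le[of "{s. real m * (\<mu> + t) \<le> s}" "measure_pmf ?S"
        "{s. real m * (- \<mu> + t) \<le> - s}"] up lo
    by simp
  finally show ?thesis by simp
qed

section \<open>Simulation of random programs by probability distributions\<close>

lemma run_0 [simp]: "run P 0 = return_pmf"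
  by (simp add: run_def fun_eq_iff)

lemma run_add: "run P (T1 + T2) s = run P T1 s \<bind> run P T2"
proof (induction T2)
  case 0
  then show ?case by (simp add: bind_return_pmf')
next
  case (Suc T2)
  have "run P (Suc T) s' = run P T s' \<bind> step P" for T s'
    by (simp add: run_def)
  with Suc show ?case by (simp add: bind_assoc_pmf)
qed

lemma run_Suc: "run P (Suc T) s = step P s \<bind> run P T"
  using run_add[of P 1 T s] by (simp add: run_def bind_return_pmf)

lemma run_Suc0 [simp]: "run P (Suc 0) = step P"
  by (simp add: run_Suc fun_eq_iff bind_return_pmf')

lemma run_numeral:
  "run P (numeral v) s = step P s \<bind> run P (pred_numeral v)"
  by (simp add: numeral_eq_Suc run_Suc)

lemma run_halted: "halted P s \<Longrightarrow> run P T s = return_pmf s"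
  by (induction T) (simp_all add: run_Suc step_def bind_return_pmf)

text \<open>A coupling of the machine state after exactly \<open>T\<close> steps with an abstract
  random value \<open>x\<close>, such that \<open>Q x\<close> holds of the state. With the one-point
  distribution it becomes \<open>reaches\<close>, a Hoare-style statement with exact running
  time.\<close>

definition sim :: "program \<Rightarrow> nat \<Rightarrow> mstate \<Rightarrow> 'a pmf \<Rightarrow> ('a \<Rightarrow> mstate \<Rightarrow> bool) \<Rightarrow> bool" where
  "sim P T s D Q \<longleftrightarrow> rel_pmf (\<lambda>s' x. Q x s') (run P T s) D"

abbreviation reaches :: "program \<Rightarrow> nat \<Rightarrow> mstate \<Rightarrow> (mstate \<Rightarrow> bool) \<Rightarrow> bool" where
  "reaches P T s Q \<equiv> sim P T s (return_pmf ()) (\<lambda>_. Q)"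

lemma sim_bind:
  assumes "sim P T1 s D Q" "\<And>x s'. Q x s' \<Longrightarrow> sim P T2 s' (D' x) Q'"
  shows "sim P (T1 + T2) s (D \<bind> D') Q'"
  using assms unfolding sim_def run_add by (blast intro: rel_pmf_bindI)

lemma sim_after:
  assumes "reaches P T1 s Q" "\<And>s'. Q s' \<Longrightarrow> sim P T2 s' D Q'"
  shows "sim P (T1 + T2) s D Q'"
  using sim_bind[of P T1 s "return_pmf ()" "\<lambda>_. Q" T2 "\<lambda>_. D" Q'] assms
  by (simp add: bind_return_pmf)

lemma sim_then_map:
  assumes "sim P T1 s D Q" "\<And>x s'. Q x s' \<Longrightarrow> reaches P T2 s' (Q' (h x))"
  shows "sim P (T1 + T2) s (map_pmf h D) Q'"
proof -
  have "sim P T2 s' (return_pmf (h x)) Q'" if "Q x s'" for x s'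
    using assms(2)[OF that] by (simp add: sim_def rel_pmf_return_pmf2)
  with assms(1) show ?thesis
    unfolding map_pmf_def by (rule sim_bind)
qed

text \<open>Every iteration costs the same \<open>c\<close> steps whatever was drawn, so the loop
  time is the fixed number \<open>m * c\<close>, while \<open>D\<close> follows its own recursion
  with body \<open>B\<close>.\<close>

lemma sim_loop:
  assumes "\<And>i x s. i < m \<Longrightarrow> I i x s \<Longrightarrow> sim P c s (B i x) (I (Suc i))"
    and "\<And>i. i < m \<Longrightarrow> D (Suc i) = D i \<bind> B i"
    and "D 0 = return_pmf x0" and "I 0 x0 s"
  shows "sim P (m * c) s (D m) (I m)"
proof -
  have "i \<le> m \<Longrightarrow> sim P (i * c) s (D i) (I i)" for i
  proof (induction i)
    case 0
    then show ?case using assms(3,4) by (simp add: sim_def)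
  next
    case (Suc i)
    then show ?case
      using sim_bind[of P "i * c" s "D i" "I i" c "B i" "I (Suc i)"] assms(1,2)[of i]
      by (simp add: add.commute)
  qed
  then show ?thesis by blast
qed

lemma reaches_loop:
  assumes "\<And>i s. i < m \<Longrightarrow> I i s \<Longrightarrow> reaches P c s (I (Suc i))" "I 0 s"
  shows "reaches P (m * c) s (I m)"
  using sim_loop[of m "\<lambda>i _. I i" P c "\<lambda>_ _. return_pmf ()" "\<lambda>_. return_pmf ()" "()" s] assms
  by (simp add: bind_return_pmf)

lemma reachesI: "run P T s = return_pmf s' \<Longrightarrow> Q s' \<Longrightarrow> reaches P T s Q"
  by (simp add: sim_def)

text \<open>Transfers a probability bound from the abstract distribution to the machine. As halted
  states are absorbing, the time may be raised from \<open>T\<close> to any larger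
  \<open>T'\<close>.\<close>

lemma sim_prob_le:
  assumes "sim P T s D Q" "T \<le> T'" "\<And>x s'. Q x s' \<Longrightarrow> halted P s'"
    and "\<And>x s'. x \<in> A \<Longrightarrow> Q x s' \<Longrightarrow> s' \<in> B"
  shows "measure_pmf.prob D A \<le> measure_pmf.prob (run P T' s) B"
proof -
  have "sim P (T + (T' - T)) s (map_pmf (\<lambda>x. x) D) Q"
    using assms(1)
    by (rule sim_then_map) (use assms(3) in \<open>simp add: sim_def run_halted\<close>)
  then have "rel_pmf (\<lambda>s' x. Q x s') (run P T' s) D"
    using assms(2) by (simp add: sim_def)
  then have "rel_pmf Q D (run P T' s)"
    by (subst (asm) pmf.rel_flip[symmetric]) (simp add: conversep_iff[abs_def])
  then have "measure_pmf.prob D A \<le> measure_pmf.prob (run P T' s) {y. \<exists>x\<in>A. Q x y}"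
    by (rule rel_pmf_measureD)
  also have "\<dots> \<le> measure_pmf.prob (run P T' s) B"
    by (rule measure_pmf.finite_measure_mono) (use assms(4) in auto)
  finally show ?thesis .
qed

section \<open>The program\<close>

text \<open>
  Operands are static addresses, and the input occupies the memory from address 0 on, so registers
  have to be freed first. For \<open>k > 0\<close> the address \<open>H = n + 12 * k\<close> lies beyond the ranking and
  beyond the registers, and can be computed without destroying \<open>n\<close> and \<open>k\<close>; the ranking moves
  to \<open>H\<close> (first its head, to obtain registers for a copying loop). The real memory then moves to
  \<open>D = 2 * n + 16\<close>, and the table of the tail probabilities starts at \<open>2 * D\<close>. The test
  \<open>1 < eps\<close> in the first lines is carried out as \<open>del < eps * del\<close> since no real register is free
  for the constant.

  Afterwards the integer registers 0 to 5 and 8 hold \<open>n\<close>, \<open>k\<close>, \<open>1\<close>, \<open>H\<close>, \<open>D\<close>, \<open>0\<close>, \<open>2 * D\<close>.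
  In the sampling loop (entered at 115) the real registers 2 to 11 hold \<open>z\<close>, \<open>q\<close>, \<open>ln (2 / del)\<close>,
  \<open>2 * eps\<^sup>2\<close>, \<open>m * 2 * eps\<^sup>2\<close>, \<open>m\<close>, the sum of the samples, the total weight and the
  Plackett-Luce product of the current sample, and \<open>1\<close>.
\<close>

definition plc_prog :: program where
  "plc_prog =
    [RMul 0 0 1, JLtR 1 0 20, RDiv 0 0 1,
     IAdd 0 0 1, IAdd 0 0 1, IAdd 0 0 1, IAdd 0 0 1, IAdd 0 0 1, IAdd 0 0 1, IAdd 0 0 1,
     IAdd 0 0 1, IAdd 0 0 1, IAdd 0 0 1, IAdd 0 0 1, IAdd 0 0 1,
     IStore 0 2, IConst 2 1, JLeI 2 1 22, RConst 0 1, Halt,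
     RConst 0 0, Halt,
     IAdd 0 0 2, IStore 0 3, IAdd 0 0 2, IStore 0 4, IAdd 0 0 2, IStore 0 5, IConst 3 5,
     ISub 0 0 3, IAdd 1 1 2, IConst 4 6,
     JLeI 4 1 34, Jmp 39, ILoad 5 4, IAdd 3 0 4, IStore 3 5, IAdd 4 4 2, Jmp 32,
     ISub 1 1 2, IAdd 0 0 2, IAdd 0 0 2, ISub 5 2 2, IAdd 3 0 5,
     ISub 0 0 1, ISub 0 0 1, ISub 0 0 1, ISub 0 0 1, ISub 0 0 1, ISub 0 0 1, ISub 0 0 1,
     ISub 0 0 1, ISub 0 0 1, ISub 0 0 1, ISub 0 0 1, ISub 0 0 1,
     IConst 6 16, IAdd 4 0 0, IAdd 4 4 6, IAdd 8 4 4, RStore 4 0, IConst 6 1,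
     JLeI 4 6 68, RLoad 0 6, IAdd 7 4 6, RStore 7 0, IAdd 6 6 2, Jmp 62,
     RConst 11 1, RStore 8 11, IConst 6 0,
     JLeI 0 6 88, IAdd 6 6 2, IAdd 9 6 6, IAdd 9 9 4, IAdd 9 9 2, RLoad 0 9, IAdd 7 8 1,
     JLeI 7 8 71, RLoad 1 7, ISub 10 7 2, RLoad 2 10, RSub 2 2 1, RMul 2 2 0, RAdd 1 1 2,
     RStore 7 1, ISub 7 7 2, Jmp 78,
     IAdd 7 8 1, RLoad 2 7, RConst 3 1, IConst 6 0,
     JLeI 1 6 104, IAdd 7 3 6, ILoad 7 7, IAdd 7 7 7, IAdd 7 7 4, IAdd 7 7 2, RLoad 0 7,
     RMul 3 3 0, RSub 0 0 0, RStore 7 0, IAdd 6 6 2, Jmp 92,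
     IAdd 7 4 2, RLoad 0 7, RConst 1 2, RDiv 0 1 0, RLn 4 0, RLoad 0 4, RMul 0 0 0, RAdd 5 0 0,
     RConst 6 0, RConst 7 0, RConst 8 0,
     JLtR 6 4 120, RMul 0 3 8, RMul 1 2 7, RDiv 0 0 1, Halt,
     RConst 9 0, IConst 6 0,
     JLeI 0 6 135, IAdd 6 6 2, IAdd 7 6 6, IAdd 7 7 4, RLoad 0 7, RExp 0 0, IAdd 7 7 2,
     RLoad 1 7, Bern 10 1, ROfInt 1 10, RMul 0 0 1, RAdd 9 9 0, Jmp 122,
     RConst 10 1, IAdd 6 1 5,
     JLeI 6 5 149, ISub 6 6 2, IAdd 7 3 6, ILoad 7 7, IAdd 7 7 7, IAdd 7 7 4, RLoad 0 7,
     RExp 0 0, RAdd 9 9 0, RDiv 0 0 9, RMul 10 10 0, Jmp 137,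
     RAdd 8 8 10, RAdd 6 6 5, RAdd 7 7 11, Jmp 115]"

lemma length_plc_prog: "length plc_prog = 153"
  by (simp add: plc_prog_def)

text \<open>Unfolds \<open>plc_prog\<close> only where an instruction is fetched with
  \<open>!\<close>, so that \<open>run plc_prog\<close> stays folded during symbolic
  execution.\<close>

lemmas plc_prog_nth = fun_cong[OF arg_cong[OF plc_prog_def, of nth]]

lemmas exec_simps = run_numeral step_def halted_def setI_def setR_def next_pc_def
  length_plc_prog plc_prog_nth bind_return_pmf

locale plc_input =
  fixes n k :: nat and u p :: "nat \<Rightarrow> real" and r :: "nat list" and eps del :: real
  assumes k_le_n: "k \<le> n" and p_bounds: "\<And>i. i \<in> {1..n} \<Longrightarrow> 0 < p i \<and> p i \<le> 1"
    and length_r: "length r = k" and distinct_r: "distinct r" and set_r: "set r \<subseteq> {1..n}"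
    and eps_pos: "0 < eps" and del_pos: "0 < del" and del_less: "del < 1"
begin

abbreviation "s0 \<equiv> init_state n k u p r eps del"
definition "f0 = imem s0"
definition "g0 = rmem s0"

lemma s0_eq: "s0 = \<lparr>pc = 0, imem = f0, rmem = g0\<rparr>"
  by (simp add: f0_def g0_def init_state_def)

lemma f0_simps: "f0 0 = int n" "f0 (Suc 0) = int k"
  by (simp_all add: f0_def init_state_def)

lemma f0_ranking: "t < k \<Longrightarrow> f0 (2 + t) = int (r ! t)"
  by (simp add: f0_def init_state_def length_r)

text \<open>For \<open>k = 0\<close> the address \<open>H\<close> equals \<open>n\<close>, so the
  first store may hit the register holding \<open>k\<close>; the value stored is then again 0, and
  the test for an empty ranking still works.\<close>

lemma f0_empty: "k = 0 \<Longrightarrow> f0 2 = 0"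
  unfolding f0_def init_state_def using length_r by simp

lemma g0_simps: "g0 0 = eps" "g0 (Suc 0) = del"
  by (simp_all add: g0_def init_state_def)

lemma g0_item: "1 \<le> i \<Longrightarrow> i \<le> n \<Longrightarrow> g0 (2 * i) = u i \<and> g0 (Suc (2 * i)) = p i"
  by (simp add: g0_def init_state_def)

lemma g0_beyond: "2 * n + 2 \<le> j \<Longrightarrow> g0 j = 0"
  by (auto simp add: g0_def init_state_def)

section \<open>Memory layout and its invariants\<close>

definition "H = n + 12 * k"
definition "D = 2 * n + 16"

lemma r_nth: "t < k \<Longrightarrow> 1 \<le> r ! t \<and> r ! t \<le> n"
  using set_r length_r nth_mem by fastforce

definition iframe :: "(nat \<Rightarrow> int) \<Rightarrow> bool" where
  "iframe f \<longleftrightarrow> f 0 = int n \<and> f (Suc 0) = int k \<and> f 2 = 1 \<and> f 3 = int H \<and> f 4 = int D \<and> f 5 = 0 \<and>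
     f 8 = 2 * int D \<and> (\<forall>t<k. f (H + t) = int (r ! t))"

text \<open>The probabilities are a parameter because the program later overwrites those of the
  ranked items by 0.\<close>

definition rframe :: "(nat \<Rightarrow> real) \<Rightarrow> (nat \<Rightarrow> real) \<Rightarrow> bool" where
  "rframe pp g \<longleftrightarrow> g 11 = 1 \<and> g D = eps \<and> g (Suc D) = del \<and>
     (\<forall>i. 1 \<le> i \<and> i \<le> n \<longrightarrow> g (D + 2 * i) = u i \<and> g (Suc (D + 2 * i)) = pp i)"

text \<open>Since the target lies in [0,1], the answer 0 is accurate here. A constant-time exit is
  needed because the time bound shrinks with growing \<open>eps\<close>, whereas the table of tail
  probabilities costs the same for every \<open>eps\<close>.\<close>

lemma large_eps:
  assumes "1 < eps"
  shows "reaches plc_prog 3 s0 (\<lambda>s. halted plc_prog s \<and> out_val s = 0)"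
  using assms del_pos
  by (simp add: sim_def exec_simps s0_eq g0_simps out_val_def)

lemma offset_ranking:
  assumes "eps \<le> 1"
  shows "reaches plc_prog 15 s0 (\<lambda>s. s = \<lparr>pc = 15, imem = f0(0 := int H), rmem = g0\<rparr>)"
proof -
  \<comment> \<open>Dividing by \<open>del\<close> undoes the multiplication made for the test, so
    the real memory is back in its initial state.\<close>
  have "g0(0 := eps) = g0" using g0_simps by (simp add: fun_eq_iff)
  then show ?thesis
    using assms del_pos
    by (simp add: sim_def exec_simps s0_eq g0_simps f0_simps H_def add.commute)
qed

lemma empty_ranking:
  assumes "k = 0"
  shows "reaches plc_prog 4 \<lparr>pc = 15, imem = f0(0 := int H), rmem = g0\<rparr>
     (\<lambda>s. halted plc_prog s \<and> out_val s = 1)"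
  using f0_empty[OF assms] f0_simps assms
  by (simp add: sim_def exec_simps out_val_def)

section \<open>Relocation of the ranking and of the real input\<close>

definition "icopy i s \<longleftrightarrow> pc s = 32 \<and> imem s 0 = int H - 2 \<and> imem s (Suc 0) = int k + 1 \<and> imem s 2 =
    1 \<and>
  imem s 4 = int i + 6 \<and> (\<forall>t<k. t < 4 + i \<longrightarrow> imem s (H + t) = int (r ! t)) \<and>
  (\<forall>t<k. 4 + i \<le> t \<longrightarrow> imem s (2 + t) = int (r ! t)) \<and> rmem s = g0"

lemma H_bounds: "0 < k \<Longrightarrow> 13 \<le> H \<and> k + 12 \<le> H"
  using k_le_n by (simp add: H_def)

text \<open>Moving the first four entries frees the integer registers 2 to 5 for the copying loop.
  Register 0 becomes \<open>H - 2\<close> because entry \<open>t\<close> is read at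
  \<open>2 + t\<close> and written at \<open>H + t\<close>. For \<open>k < 4\<close> the surplus
  stores fall beyond the ranking.\<close>

lemma save_ranking_head:
  assumes "0 < k"
  shows "reaches plc_prog 13 \<lparr>pc = 15, imem = f0(0 := int H), rmem = g0\<rparr> (icopy 0)"
proof -
  have tail: "f0 (Suc (Suc t)) = int (r ! t)" if "t < k" for t
    using f0_ranking[OF that] by simp
  show ?thesis
    using H_bounds[OF assms] assms f0_ranking[of 0] f0_ranking[of 1] f0_ranking[of 2]
        f0_ranking[of 3]
      f0_simps
    by (simp add: sim_def exec_simps icopy_def nat_add_distrib)
       (auto simp: less_Suc_eq numeral_eq_Suc tail)
qed

lemma icopy_step:
  assumes "i < k - 4" "icopy i s"
  shows "reaches plc_prog 6 s (icopy (Suc i))"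
proof (cases s)
  case (fields l f g)
  have k: "0 < k" "4 + i < k" using assms(1) by simp_all
  have inv: "l = 32" "f 0 = int H - 2" "f (Suc 0) = int k + 1" "f 2 = 1" "f 4 = int i + 6"
    using assms(2) fields by (simp_all add: icopy_def)
  have src: "nat (int i + 6) = i + 6" by simp
  have dst: "nat (4 + (int H + int i)) = H + (4 + i)" by simp
  have "\<forall>t<k. 4 + i \<le> t \<longrightarrow> f (2 + t) = int (r ! t)"
    using assms(2) fields by (simp add: icopy_def)
  with k(2) have "f (i + 6) = int (r ! (4 + i))"
    by (auto simp: add.commute dest!: spec[of _ "4 + i"])
  then have run: "run plc_prog 6 s = return_pmf \<lparr>pc = 32, imem = f(5 := int (r ! (4 + i)),
      3 := 4 + (int H + int i), H + (4 + i) := int (r ! (4 + i)), 4 := 7 + int i), rmem = g\<rparr>"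
    using inv k H_bounds[OF k(1)]
    by (simp add: exec_simps fields src dst)
  show ?thesis
    by (rule reachesI[OF run]) (use assms(2) inv k H_bounds[OF k(1)] in \<open>auto simp: icopy_def
        fields less_Suc_eq\<close>)
qed

text \<open>Cell 0 is copied before the loop, as it then serves as transfer register. That the
  memory beyond \<open>D + i\<close> is still 0 provides the initial row of the table of tail
  probabilities.\<close>

definition "rcopy i s \<longleftrightarrow> pc s = 62 \<and> iframe (imem s) \<and> imem s 6 = int i + 1 \<and>
  (\<forall>j\<le>i. rmem s (D + j) = g0 j) \<and> (\<forall>j. i < j \<and> j < D \<longrightarrow> rmem s j = g0 j) \<and>
  (\<forall>j>D + i. rmem s j = 0)"

lemma icopy_exit:
  assumes "0 < k" "icopy (k - 4) s"
  shows "reaches plc_prog 25 s (rcopy 0)"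
proof (cases s)
  case (fields l f g)
  have inv: "l = 32" "f 0 = int H - 2" "f (Suc 0) = int k + 1" "f 2 = 1" "f 4 = int (k - 4) + 6"
      "g = g0"
    and r: "\<And>t. t < k \<Longrightarrow> f (H + t) = int (r ! t)"
    using assms(2) fields by (simp_all add: icopy_def)
  have H: "int H = int n + 12 * int k" by (simp add: H_def)
  \<comment> \<open>Also right for \<open>k < 4\<close>: the truncated subtraction gives 0
    iterations, and the loop test indeed fails at once, because 6 exceeds
    \<open>k + 1\<close>.\<close>
  have gt: "\<not> int (k - 4) + 6 \<le> int k + 1" by simp
  define f' where "f' = f(1 := int k, 5 := 0, 3 := int H, 0 := int n)"
  \<comment> \<open>The first 19 steps leave the loop and recover \<open>k\<close>, \<open>H\<close>
    and, by twelve subtractions of \<open>k\<close>, the number \<open>n\<close>. The remaining 6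
    set up \<open>D\<close> and the table address.\<close>
  have "run plc_prog 19 s = return_pmf \<lparr>pc = 56, imem = f', rmem = g0\<rparr>"
    using inv gt by (simp add: exec_simps fields H f'_def)
  moreover have "nat (2 * int n + 16) = D" "int D = 2 * int n + 16" by (simp_all add: D_def)
  then have "run plc_prog 6 \<lparr>pc = 56, imem = f', rmem = g0\<rparr> = return_pmf \<lparr>pc = 62,
     imem = f'(4 := int D, 8 := 2 * int D, 6 := 1), rmem = g0(D := eps)\<rparr>"
    by (simp add: exec_simps f'_def g0_simps)
  ultimately have run: "run plc_prog (19 + 6) s = return_pmf \<lparr>pc = 62,
     imem = f'(4 := int D, 8 := 2 * int D, 6 := 1), rmem = g0(D := eps)\<rparr>"
    unfolding run_add by (simp add: bind_return_pmf)
  have "iframe (f'(4 := int D, 8 := 2 * int D, 6 := 1))"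
    using H_bounds[OF assms(1)] r inv by (simp add: iframe_def f'_def)
  then have "rcopy 0 \<lparr>pc = 62, imem = f'(4 := int D, 8 := 2 * int D, 6 := 1), rmem = g0(D := eps)\<rparr>"
    using g0_beyond by (simp add: rcopy_def g0_simps D_def)
  with reachesI[OF run] show ?thesis by simp
qed

lemma D_bounds: "16 \<le> D \<and> 2 * n + 16 \<le> D"
  by (simp add: D_def)

lemma iframeD:
  assumes "iframe f"
  shows "f 0 = int n" "f (Suc 0) = int k" "f 2 = 1" "f 3 = int H" "f 4 = int D" "f 5 = 0"
     "f 8 = 2 * int D" "t < k \<Longrightarrow> f (H + t) = int (r ! t)"
  using assms by (auto simp: iframe_def)

lemma iframe_upd:
  "0 < k \<Longrightarrow> iframe f \<Longrightarrow> a \<in> {6, 7, 9, 10} \<Longrightarrow> iframe (f(a := v))"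
  using H_bounds by (auto simp: iframe_def)

lemma rframeD:
  assumes "rframe pp g"
  shows "g 11 = 1" "g D = eps" "g (Suc D) = del"
    "i \<in> {1..n} \<Longrightarrow> g (D + 2 * i) = u i" "i \<in> {1..n} \<Longrightarrow> g (Suc (D + 2 * i)) = pp i"
  using assms by (auto simp: rframe_def)

lemma rframe_upd:
  assumes "rframe pp g" "a < 11 \<or> 2 * D \<le> a"
  shows "rframe pp (g(a := v))"
  using assms D_bounds by (auto simp: rframe_def)

lemma rcopy_step:
  assumes "0 < k" "i < D - 1" "rcopy i s"
  shows "reaches plc_prog 6 s (rcopy (Suc i))"
proof (cases s)
  case (fields l f g)
  have inv: "l = 62" "f 2 = 1" "f 4 = int D" "f 6 = int i + 1" "iframe f" "g (Suc i) = g0 (Suc i)"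
    using assms(2,3) fields by (simp_all add: rcopy_def iframe_def)
  have addr: "nat (int i + 1) = Suc i" "nat (int D + (int i + 1)) = D + Suc i" by simp_all
  have lt: "\<not> int D \<le> int i + 1" using assms(2) by simp
  have run: "run plc_prog 6 s = return_pmf \<lparr>pc = 62, imem =
      f(7 := int D + (int i + 1), 6 := 2 + int i),
     rmem = g(0 := g0 (Suc i), D + Suc i := g0 (Suc i))\<rparr>"
    using inv lt
    by (simp add: exec_simps fields addr)
  show ?thesis
    by (rule reachesI[OF run]) (use assms fields inv D_bounds in \<open>auto simp: rcopy_def iframe_upd
        le_Suc_eq\<close>)
qed

section \<open>The table of tail probabilities\<close>

definition "dp_outer i s \<longleftrightarrow> pc s = 71 \<and> iframe (imem s) \<and> rframe p (rmem s) \<and> imem s 6 = int i \<and>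
   (\<forall>j\<le>k. rmem s (2 * D + j) = z_kp i j p)"

lemma rcopy_exit:
  assumes "0 < k" "rcopy (D - 1) s"
  shows "reaches plc_prog 4 s (dp_outer 0)"
proof (cases s)
  case (fields l f g)
  have inv: "l = 62" "f 2 = 1" "f 4 = int D" "f 6 = int D" "f 8 = 2 * int D" "iframe f"
    using assms(2) D_bounds fields by (simp_all add: rcopy_def iframe_def)
  have high: "\<And>j. 2 * D \<le> j \<Longrightarrow> g j = 0"
    using assms(2) D_bounds fields by (auto simp add: rcopy_def)
  have addr: "nat (2 * int D) = 2 * D" by simp
  have run: "run plc_prog 4 s = return_pmf \<lparr>pc = 71, imem = f(6 := 0),
     rmem = g(11 := 1, 2 * D := 1)\<rparr>"
    using inv
    by (simp add: exec_simps fields addr)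
  have g: "\<And>j. j < D \<Longrightarrow> g (D + j) = g0 j"
    using assms(2) D_bounds by (auto simp: rcopy_def fields)
  have "rframe p (g(11 := 1, 2 * D := 1))"
    using g[of 0] g[of 1] g[of "2 * i" for i] g[of "Suc (2 * i)" for i] D_bounds g0_simps g0_item
    by (auto simp: rframe_def)
  moreover have "z_kp 0 j p = (if j = 0 then 1 else 0)" for j
    by (cases j) (simp_all add: z_kp_zero z_kp_0_Suc)
  ultimately show ?thesis
    by (intro reachesI[OF run]) (use assms(1) inv high D_bounds in \<open>auto simp: dp_outer_def
        iframe_upd\<close>)
qed

text \<open>The row is updated in place from index \<open>k\<close> downwards, so that the old value
  at the next lower index is still available; indices above \<open>k - j\<close> are already
  new.\<close>

definition "dp_inner i j s \<longleftrightarrow> pc s = 78 \<and> iframe (imem s) \<and> rframe p (rmem s) \<and>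
   imem s 6 = int (Suc i) \<and> imem s 7 = 2 * int D + (int k - int j) \<and> rmem s 0 = p (Suc i) \<and>
   (\<forall>j'\<le>k. rmem s (2 * D + j') = z_kp (if k - j < j' then Suc i else i) j' p)"

lemma dp_outer_start:
  assumes "0 < k" "i < n" "dp_outer i s"
  shows "reaches plc_prog 7 s (dp_inner i 0)"
proof (cases s)
  case (fields l f g)
  have inv: "l = 71" "iframe f" "rframe p g" "f 6 = int i"
    using assms(2,3) fields by (auto simp: dp_outer_def)
  have p: "g (Suc (D + 2 * Suc i)) = p (Suc i)"
    using rframeD(5)[OF inv(3), of "Suc i"] assms(2) by simp
  have addr: "nat (3 + (2 * int i + int D)) = Suc (D + 2 * Suc i)" by simp
  have run: "run plc_prog 7 s = return_pmf \<lparr>pc = 78, imem =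
      f(6 := int i + 1, 9 := 3 + (2 * int i + int D),
     7 := 2 * int D + int k), rmem = g(0 := p (Suc i))\<rparr>"
    using inv(1,4) p iframeD(1-7)[OF inv(2)] assms(2)
    by (simp add: exec_simps fields addr)
  show ?thesis
    by (rule reachesI[OF run]) (use assms fields inv D_bounds in \<open>auto simp: dp_outer_def
        dp_inner_def iframe_upd rframe_upd\<close>)
qed

lemma dp_inner_step:
  assumes "0 < k" "j < k" "dp_inner i j s"
  shows "reaches plc_prog 10 s (dp_inner i (Suc j))"
proof (cases s)
  case (fields l f g)
  define a where "a = k - Suc j"
  have a: "k - j = Suc a" "int k - int j = int a + 1" "Suc a \<le> k" using assms(2)
      by (auto simp: a_def)
  have inv: "l = 78" "iframe f" "rframe p g" "f 6 = int (Suc i)" "f 7 = 2 * int D + (int a + 1)"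
      "g 0 = p (Suc i)"
    and tab: "\<And>j'. j' \<le> k \<Longrightarrow> g (2 * D + j') = z_kp (if Suc a < j' then Suc i else i) j' p"
    using assms(2,3) fields a by (auto simp: dp_inner_def)
  have g: "g (Suc (2 * D + a)) = z_kp i (Suc a) p" "g (2 * D + a) = z_kp i a p"
    using tab[of "Suc a"] tab[of a] a by simp_all
  have addr: "nat (2 * int D + (int a + 1)) = Suc (2 * D + a)"
      "nat (2 * int D + int a) = 2 * D + a" by simp_all
  have z: "z_kp (Suc i) (Suc a) p = z_kp i (Suc a) p + (z_kp i a p - z_kp i (Suc a) p) * p (Suc i)"
    by (rule z_kp_Suc_Suc)
  have run: "run plc_prog 10 s = return_pmf \<lparr>pc = 78, imem = f(10 := 2 * int D + int a,
     7 := 2 * int D + int a), rmem = g(2 := (z_kp i a p - z_kp i (Suc a) p) * p (Suc i),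
       1 := z_kp (Suc i) (Suc a) p, Suc (2 * D + a) := z_kp (Suc i) (Suc a) p)\<rparr>"
    using inv(1,4-6) g D_bounds iframeD(1-7)[OF inv(2)]
    by (simp add: exec_simps fields addr z)
  have kj: "k - Suc j = a" "int k - int (Suc j) = int a" using a by auto
  have tab': "(g(2 := x, 1 := y, Suc (2 * D + a) := z_kp (Suc i) (Suc a) p)) (2 * D + j') =
     z_kp (if a < j' then Suc i else i) j' p" if "j' \<le> k" for j' x y
    using tab[OF that] D_bounds by (auto simp: less_Suc_eq)
  show ?thesis
    by (rule reachesI[OF run], unfold dp_inner_def mstate.simps kj,
        intro conjI allI impI tab' iframe_upd rframe_upd inv)
       (use assms(1) inv D_bounds in auto)
qed

text \<open>Index 0 is never rewritten, which is correct because that tail probability is 1 in every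
  row.\<close>

lemma dp_inner_exit:
  assumes "0 < k" "dp_inner i k s"
  shows "reaches plc_prog 1 s (dp_outer (Suc i))"
proof (cases s)
  case (fields l f g)
  have inv: "l = 78" "iframe f" "rframe p g" "f 6 = int (Suc i)" "f 7 = 2 * int D"
    and tab: "\<And>j'. j' \<le> k \<Longrightarrow> g (2 * D + j') = z_kp (if 0 < j' then Suc i else i) j' p"
    using assms fields by (auto simp: dp_inner_def)
  have run: "run plc_prog 1 s = return_pmf \<lparr>pc = 71, imem = f, rmem = g\<rparr>"
    using inv(1,4,5) iframeD(1-7)[OF inv(2)]
    by (simp add: exec_simps fields)
  show ?thesis
    by (rule reachesI[OF run]) (use inv tab in \<open>auto simp: dp_outer_def z_kp_zero\<close>)
qed

lemma dp_outer_step: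
  assumes "0 < k" "i < n" "dp_outer i s"
  shows "reaches plc_prog (10 * k + 8) s (dp_outer (Suc i))"
proof -
  have "reaches plc_prog (7 + (k * 10 + 1)) s (dp_outer (Suc i))"
    by (intro sim_after[OF dp_outer_start[OF assms]] sim_after[OF reaches_loop[of k "dp_inner i"]]
          dp_inner_step dp_inner_exit assms)
  then show ?thesis by (simp add: algebra_simps)
qed

section \<open>Separating the ranked items from the sampled ones\<close>

definition "q = (\<Prod>t<k. p (r ! t))"
definition "p' i = (if i \<in> set r then 0 else p i)"
definition "e i = exp (u i)"
text \<open>The Plackett-Luce probability of \<open>r\<close> when the considered unranked items
  have total weight \<open>w\<close>: the denominator at position \<open>t\<close> is
  \<open>w\<close> plus the weight of the ranked items not yet chosen.\<close>

definition "pl_val w = (\<Prod>t<k. e (r ! t) / (w + (\<Sum>s\<in>{t..<k}. e (r ! s))))"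
definition "sample_pmf = map_pmf pl_val (subset_sum_pmf p' e n)"

definition "rpass t s \<longleftrightarrow> pc s = 92 \<and> iframe (imem s) \<and>
   rframe (\<lambda>i. if i \<in> set (take t r) then 0 else p i) (rmem s) \<and> imem s 6 = int t \<and>
   rmem s 2 = z_kp n k p \<and> rmem s 3 = (\<Prod>s<t. p (r ! s))"

lemma dp_outer_exit:
  assumes "0 < k" "dp_outer n s"
  shows "reaches plc_prog 5 s (rpass 0)"
proof (cases s)
  case (fields l f g)
  have inv: "l = 71" "iframe f" "rframe p g" "f 6 = int n" "g (2 * D + k) = z_kp n k p"
    using assms fields by (auto simp: dp_outer_def)
  have addr: "nat (2 * int D + int k) = 2 * D + k" by simp
  have run: "run plc_prog 5 s = return_pmf \<lparr>pc = 92, imem = f(7 := 2 * int D + int k, 6 := 0),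
     rmem = g(2 := z_kp n k p, 3 := 1)\<rparr>"
    using inv(1,4,5) iframeD(1-7)[OF inv(2)]
    by (simp add: exec_simps fields addr)
  show ?thesis
    by (rule reachesI[OF run]) (use assms inv in \<open>simp add: rpass_def iframe_upd rframe_upd\<close>)
qed

lemma rframe_upd_p:
  assumes "rframe pp g" "i \<in> {1..n}"
  shows "rframe (pp(i := v)) (g(Suc (D + 2 * i) := v))"
proof -
  have "Suc (D + 2 * i) \<noteq> D + 2 * j" for j by presburger
  then show ?thesis
    using assms D_bounds by (auto simp: rframe_def)
qed

lemma rpass_step:
  assumes "0 < k" "t < k" "rpass t s"
  shows "reaches plc_prog 12 s (rpass (Suc t))"
proof (cases s)
  case (fields l f g)
  define pp where "pp = (\<lambda>i. if i \<in> set (take t r) then 0 else p i)"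
  have inv: "l = 92" "iframe f" "rframe pp g" "f 6 = int t" "g 2 = z_kp n k p"
      "g 3 = (\<Prod>s<t. p (r ! s))"
    using assms fields by (auto simp: rpass_def pp_def)
  have rt: "r ! t \<in> {1..n}" using r_nth[OF assms(2)] by simp
  \<comment> \<open>By distinctness the probability of this item has not been overwritten yet, so
    the correct factor enters \<open>q\<close>.\<close>
  have "r ! t \<notin> set (take t r)"
    using distinct_r assms(2) length_r by (auto simp: in_set_conv_nth nth_eq_iff_index_eq)
  then have ppt: "pp (r ! t) = p (r ! t)" by (simp add: pp_def)
  have g: "g (Suc (D + 2 * (r ! t))) = p (r ! t)" using rframeD(5)[OF inv(3) rt] ppt by simp
  have f: "f (H + t) = int (r ! t)" using iframeD(8)[OF inv(2) assms(2)] .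
  have addr: "nat (int H + int t) = H + t" "nat (2 * int (r ! t) + int D + 1) =
      Suc (D + 2 * (r ! t))" by simp_all
  have run: "run plc_prog 12 s = return_pmf \<lparr>pc = 92, imem =
      f(7 := 2 * int (r ! t) + int D + 1, 6 := int t + 1),
     rmem = g(3 := (\<Prod>s<t. p (r ! s)) * p (r ! t), 0 := 0, Suc (D + 2 * (r ! t)) := 0)\<rparr>"
    using inv(1,4-6) iframeD(1-7)[OF inv(2)] g f assms(2) H_bounds[OF assms(1)] D_bounds
    by (simp add: exec_simps fields addr)
  have pp': "(\<lambda>i. if i \<in> set (take (Suc t) r) then 0 else p i) = pp(r ! t := 0)"
    using assms(2) length_r by (auto simp: pp_def take_Suc_conv_app_nth)
  show ?thesis
    by (rule reachesI[OF run])
       (use assms inv rt D_bounds in \<open>simp add: rpass_def iframe_upd rframe_upd rframe_upd_p pp'\<close>)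
qed

section \<open>The sampling loop\<close>

definition "acc m x g \<longleftrightarrow> rframe p' g \<and>
  g 2 = z_kp n k p \<and> g 3 = q \<and> g 4 = ln (2 / del) \<and> g 5 = 2 * eps\<^sup>2 \<and>
  g 6 = real m * (2 * eps\<^sup>2) \<and> g 7 = real m \<and> g 8 = x"

lemma acc_upd: "acc m x g \<Longrightarrow> a \<in> {0, 1, 9, 10} \<Longrightarrow> acc m x (g(a := v))"
  by (auto simp: acc_def rframe_upd)

definition "sampling m x s \<longleftrightarrow> pc s = 115 \<and> iframe (imem s) \<and> acc m x (rmem s)"

lemma rpass_exit:
  assumes "0 < k" "rpass k s"
  shows "reaches plc_prog 12 s (sampling 0 0)"
proof (cases s)
  case (fields l f g)
  have "p' = (\<lambda>i. if i \<in> set (take k r) then 0 else p i)"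
    using length_r by (auto simp: p'_def)
  then have inv: "l = 92" "iframe f" "rframe p' g" "f 6 = int k" "g 2 = z_kp n k p" "g 3 = q"
    using assms fields by (auto simp: rpass_def q_def)
  have addr: "nat (int D + 1) = Suc D" by simp
  have run: "run plc_prog 12 s = return_pmf \<lparr>pc = 115, imem = f(7 := int D + 1),
     rmem = g(1 := 2, 4 := ln (2 / del), 0 := eps * eps, 5 := 2 * (eps *
         eps), 6 := 0, 7 := 0, 8 := 0)\<rparr>"
    using inv(1,4-6) iframeD(1-7)[OF inv(2)] rframeD(2,3)[OF inv(3)] D_bounds
    by (simp add: exec_simps fields addr)
  show ?thesis
    by (rule reachesI[OF run])
       (use assms inv in \<open>simp add: sampling_def acc_def iframe_upd rframe_upd power2_eq_square\<close>)
qed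

definition "draw m x i w s \<longleftrightarrow> pc s = 122 \<and> iframe (imem s) \<and> acc m x (rmem s) \<and> imem s 6 =
    int i \<and> rmem s 9 = w"

text \<open>The loop test compares the running value \<open>m * 2 * eps\<^sup>2\<close> with
  \<open>ln (2 / del)\<close>. The number of samples is thus determined without rounding, for which
  the machine has no instruction.\<close>

lemma draw_start:
  assumes "0 < k" "real m * (2 * eps\<^sup>2) < ln (2 / del)" "sampling m x s"
  shows "reaches plc_prog 3 s (draw m x 0 0)"
proof (cases s)
  case (fields l f g)
  have inv: "l = 115" "iframe f" "acc m x g"
    using assms fields by (auto simp: sampling_def)
  have run: "run plc_prog 3 s = return_pmf \<lparr>pc = 122, imem = f(6 := 0), rmem = g(9 := 0)\<rparr>"
    using inv(1) assms(2) inv(3)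
    by (simp add: exec_simps fields acc_def)
  show ?thesis
    by (rule reachesI[OF run])
       (use assms inv in \<open>simp add: draw_def iframe_upd acc_upd\<close>)
qed

text \<open>The random bit is multiplied with the weight instead of being branched on, so both
  outcomes take 13 steps.\<close>

lemma draw_step:
  assumes "0 < k" "i < n" "draw m x i w s"
  shows "sim plc_prog 13 s
     (map_pmf (\<lambda>b. w + (if b then e (Suc i) else 0)) (bernoulli_pmf (p' (Suc i)))) (draw m x (Suc
         i))"
proof (cases s)
  case (fields l f g)
  have inv: "l = 122" "iframe f" "acc m x g" "f 6 = int i" "g 9 = w"
    using assms fields by (auto simp: draw_def)
  have g: "g (D + 2 * Suc i) = u (Suc i)" "g (Suc (D + 2 * Suc i)) = p' (Suc i)"
    using rframeD(4,5)[of p' g "Suc i"] inv(3) assms(2) by (simp_all add: acc_def)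
  have addr: "nat (2 * int i + 2 + int D) = D + 2 * Suc i"
      "nat (3 + (2 * int i + int D)) = Suc (D + 2 * Suc i)" by simp_all
  define f' where "f' b = f(6 := int i + 1, 7 := 3 + (2 * int i +
      int D), 10 := if b then 1 else 0)" for b
  define s' where "s' b = \<lparr>pc = 122, imem = f' b, rmem = g(1 := if b then 1 else 0,
     0 := if b then e (Suc i) else 0, 9 := w + (if b then e (Suc i) else 0))\<rparr>" for b
  \<comment> \<open>The ninth step is the Bernoulli instruction; what follows is deterministic for
    each value of the bit.\<close>
  have run9: "run plc_prog 9 s = map_pmf (\<lambda>b. \<lparr>pc = 131, imem = f' b,
      rmem = g(0 := e (Suc i), Suc 0 := p' (Suc i))\<rparr>) (bernoulli_pmf (p' (Suc i)))"
    using inv(1,4-5) iframeD(1-7)[OF inv(2)] g assms(2) D_bounds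
    by (simp add: exec_simps fields addr f'_def e_def)
  have run4: "run plc_prog 4 \<lparr>pc = 131, imem = f' b, rmem =
      g(0 := e (Suc i), Suc 0 := p' (Suc i))\<rparr> = return_pmf (s' b)" for b
    using inv(5) by (simp add: exec_simps f'_def s'_def fun_upd_twist)
  have run: "run plc_prog 13 s = map_pmf s' (bernoulli_pmf (p' (Suc i)))"
    using run_add[of plc_prog 9 4 s] unfolding run9
        by (simp add: run4 map_pmf_def bind_assoc_pmf bind_return_pmf)
  have "draw m x (Suc i) (w + (if b then e (Suc i) else 0)) (s' b)" for b
    using inv assms(1) by (simp add: draw_def s'_def f'_def iframe_upd acc_upd)
  then show ?thesis
    unfolding sim_def run pmf.rel_map by (intro rel_pmf_reflI)
qed

text \<open>The positions are processed from the last to the first, so that each denominator arises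
  from the previous one by one addition and the product takes time linear in
  \<open>k\<close>.\<close>

definition "ranking m x w j s \<longleftrightarrow> pc s = 137 \<and> iframe (imem s) \<and> acc m x (rmem s) \<and> imem s 6 =
    int (k - j) \<and>
  rmem s 9 = w + (\<Sum>s\<in>{k - j..<k}. e (r ! s)) \<and>
  rmem s 10 = (\<Prod>t\<in>{k - j..<k}. e (r ! t) / (w + (\<Sum>s\<in>{t..<k}. e (r ! s))))"

lemma draw_exit:
  assumes "0 < k" "draw m x n w s"
  shows "reaches plc_prog 3 s (ranking m x w 0)"
proof (cases s)
  case (fields l f g)
  have inv: "l = 122" "iframe f" "acc m x g" "f 6 = int n" "g 9 = w"
    using assms fields by (auto simp: draw_def)
  have run: "run plc_prog 3 s = return_pmf \<lparr>pc = 137, imem = f(6 := int k), rmem = g(10 := 1)\<rparr>"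
    using inv(1,4) iframeD(1-7)[OF inv(2)]
    by (simp add: exec_simps fields)
  show ?thesis
    by (rule reachesI[OF run])
       (use assms inv in \<open>simp add: ranking_def iframe_upd acc_upd\<close>)
qed

lemma ranking_step:
  assumes "0 < k" "j < k" "ranking m x w j s"
  shows "reaches plc_prog 12 s (ranking m x w (Suc j))"
proof (cases s)
  case (fields l f g)
  define a where "a = k - Suc j"
  have a: "k - j = Suc a" "k - Suc j = a" "a < k" using assms(2) by (auto simp: a_def)
  define W where "W = w + (\<Sum>s\<in>{Suc a..<k}. e (r ! s))"
  define R where "R = (\<Prod>t\<in>{Suc a..<k}. e (r ! t) / (w + (\<Sum>s\<in>{t..<k}. e (r ! s))))"
  have inv: "l = 137" "iframe f" "acc m x g" "f 6 = int a + 1" "g 9 = W" "g 10 = R"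
    using assms fields a by (auto simp: ranking_def W_def R_def)
  have g: "g (D + 2 * (r ! a)) = u (r ! a)"
    using rframeD(4)[of p' g "r ! a"] inv(3) r_nth[OF a(3)] by (simp add: acc_def)
  have f: "f (H + a) = int (r ! a)" using iframeD(8)[OF inv(2) a(3)] .
  have addr: "nat (int H + int a) = H + a" "nat (2 * int (r ! a) + int D) =
      D + 2 * (r ! a)" by simp_all
  have run: "run plc_prog 12 s = return_pmf \<lparr>pc = 137, imem =
      f(6 := int a, 7 := 2 * int (r ! a) + int D),
     rmem = g(9 := W + e (r ! a), 0 := e (r ! a) / (W + e (r ! a)), 10 := R * (e (r ! a) / (W +
         e (r ! a))))\<rparr>"
    using inv(1,4-6) iframeD(1-7)[OF inv(2)] g f D_bounds H_bounds[OF assms(1)]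
    by (simp add: exec_simps fields addr e_def)
  have W: "w + (\<Sum>s\<in>{a..<k}. e (r ! s)) = W + e (r ! a)"
    using a(3) by (simp add: W_def sum.atLeast_Suc_lessThan)
  then have R: "(\<Prod>t\<in>{a..<k}. e (r ! t) / (w + (\<Sum>s\<in>{t..<k}. e (r ! s)))) =
      R * (e (r ! a) / (W + e (r ! a)))"
    using a(3) by (simp add: R_def prod.atLeast_Suc_lessThan)
  show ?thesis
    by (rule reachesI[OF run])
       (use assms inv in \<open>simp add: ranking_def iframe_upd acc_upd a(2) W R\<close>)
qed

lemma ranking_exit:
  assumes "0 < k" "ranking m x w k s"
  shows "reaches plc_prog 5 s (sampling (Suc m) (x + pl_val w))"
proof (cases s)
  case (fields l f g)
  have inv: "l = 137" "iframe f" "acc m x g" "f 6 = 0" "g 10 = pl_val w"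
    using assms fields by (auto simp: ranking_def pl_val_def atLeast0LessThan)
  have run: "run plc_prog 5 s = return_pmf \<lparr>pc = 115, imem = f,
     rmem = g(8 := x + pl_val w, 6 := real m * (2 * eps\<^sup>2) + 2 * eps\<^sup>2, 7 := real m + 1)\<rparr>"
    using inv(1,4,5) iframeD(1-7)[OF inv(2)] inv(3) rframeD(1)[of p' g]
    by (simp add: exec_simps fields acc_def)
  show ?thesis
    by (rule reachesI[OF run])
       (use assms inv in \<open>auto simp: sampling_def acc_def rframe_upd algebra_simps\<close>)
qed

lemma sampling_step:
  assumes "0 < k" "real m * (2 * eps\<^sup>2) < ln (2 / del)" "sampling m x s"
  shows "sim plc_prog (13 * n + 12 * k + 11) s (map_pmf (\<lambda>y. x + y) sample_pmf) (sampling (Suc m))"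
proof -
  have rank: "reaches plc_prog (3 + (k * 12 + 5)) s' (sampling (Suc m) (x + pl_val w))"
      if "draw m x n w s'" for w s'
    by (intro sim_after[OF draw_exit[OF assms(1) that]]
        sim_after[OF reaches_loop[of k "ranking m x w"]]
          ranking_step ranking_exit assms)
  have draw: "sim plc_prog (n * 13) s' (subset_sum_pmf p' e n) (draw m x n)"
      if "draw m x 0 0 s'" for s'
    by (rule sim_loop[where I = "draw m x" and D = "subset_sum_pmf p' e"
          and B = "\<lambda>i w. map_pmf (\<lambda>b. w + (if b then e (Suc i) else 0)) (bernoulli_pmf (p' (Suc
              i)))"])
       (use that draw_step[OF assms(1)] in simp_all)
  have "sim plc_prog (3 + (n * 13 + (3 + (k * 12 + 5)))) s
     (map_pmf (\<lambda>w. x + pl_val w) (subset_sum_pmf p' e n)) (sampling (Suc m))"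
    by (intro sim_after[OF draw_start[OF assms]] sim_then_map[OF draw] rank)
  then show ?thesis
    by (simp add: sample_pmf_def pmf.map_comp o_def algebra_simps)
qed

lemma sampling_exit:
  assumes "ln (2 / del) \<le> real m * (2 * eps\<^sup>2)" "sampling m x s"
  shows "reaches plc_prog 4 s (\<lambda>s. halted plc_prog s \<and> out_val s = q * x / (z_kp n k p * real m))"
proof (cases s)
  case (fields l f g)
  have inv: "l = 115" "iframe f" "acc m x g"
    using assms fields by (auto simp: sampling_def)
  have run: "run plc_prog 4 s = return_pmf \<lparr>pc = 119, imem = f,
    rmem = g(1 := z_kp n k p * real m, 0 := q * x / (z_kp n k p * real m))\<rparr>"
    using inv(1) assms(1) inv(3)
    by (simp add: exec_simps fields acc_def)
  show ?thesis
    by (rule reachesI[OF run]) (simp add: exec_simps out_val_def)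
qed

definition "run_time m = 28 + ((k - 4) * 6 + (25 + ((D - 1) * 6 + (4 + (n * (10 * k + 8) +
   (5 + (k * 12 + (12 + (m * (13 * n + 12 * k + 11) + 4)))))))))"

text \<open>The two conditions say that \<open>m\<close> is the first count at which the loop test
  fails, so exactly \<open>m\<close> samples are drawn. The phases are chained through their
  invariants, their costs adding up to \<open>run_time m\<close>.\<close>

lemma plc_prog_correct:
  assumes k: "0 < k" and "eps \<le> 1"
    and m: "ln (2 / del) \<le> real m * (2 * eps\<^sup>2)" "\<And>i. i < m \<Longrightarrow> real i * (2 * eps\<^sup>2) < ln (2 / del)"
  shows "sim plc_prog (run_time m) s0 (iid_sum_pmf sample_pmf m)
     (\<lambda>x s. halted plc_prog s \<and> out_val s = q * x / (z_kp n k p * real m))"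
proof -
  have main: "sim plc_prog (m * (13 * n + 12 * k + 11) + 4) s (iid_sum_pmf sample_pmf m)
     (\<lambda>x s. halted plc_prog s \<and> out_val s = q * x / (z_kp n k p * real m))"
         if "sampling 0 0 s" for s
  proof -
    have "sim plc_prog (m * (13 * n + 12 * k + 11)) s (iid_sum_pmf sample_pmf m) (sampling m)"
      by (rule sim_loop[where D = "iid_sum_pmf sample_pmf" and B =
          "\<lambda>_ x. map_pmf (\<lambda>y. x + y) sample_pmf"
            and I = sampling])
        (use that sampling_step[OF k] m(2) in simp_all)
    from sim_then_map[OF this, of 4 _ "\<lambda>x. x"] show ?thesis
      using sampling_exit[OF m(1)] by simp
  qed
  have start: "reaches plc_prog (15 + 13) s0 (icopy 0)"
    by (rule sim_after[OF offset_ranking]) (use save_ranking_head assms in auto)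
  show ?thesis unfolding run_time_def
    by (intro sim_after[OF start[simplified]] sim_after[OF reaches_loop[of "k - 4" icopy]]
       sim_after[OF icopy_exit] sim_after[OF reaches_loop[of "D - 1" rcopy]]
           sim_after[OF rcopy_exit]
       sim_after[OF reaches_loop[of n dp_outer]] sim_after[OF dp_outer_exit]
           sim_after[OF reaches_loop[of k rpass]]
       sim_after[OF rpass_exit] icopy_step rcopy_step dp_outer_step rpass_step main k)
qed

section \<open>Accuracy and running time\<close>

lemma p_nonneg: "i \<in> {1..n} \<Longrightarrow> 0 \<le> p i \<and> p i \<le> 1"
  using p_bounds by fastforce

lemma p'_bounds: "i \<in> {1..n} \<Longrightarrow> 0 \<le> p' i \<and> p' i \<le> 1"
  using p_nonneg by (simp add: p'_def)

lemma e_pos: "0 < e i"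
  by (simp add: e_def)

text \<open>Each numerator is one of the nonnegative summands of its denominator.\<close>

lemma pl_val_bounds:
  assumes "0 \<le> w"
  shows "0 \<le> pl_val w \<and> pl_val w \<le> 1"
proof -
  have "0 \<le> e (r ! t) / (w + (\<Sum>s\<in>{t..<k}. e (r ! s))) \<and>
      e (r ! t) / (w + (\<Sum>s\<in>{t..<k}. e (r ! s))) \<le> 1" if "t < k" for t
  proof -
    have "e (r ! t) \<le> (\<Sum>s\<in>{t..<k}. e (r ! s))"
      using that e_pos by (intro member_le_sum) (auto simp: less_imp_le)
    moreover have "0 < e (r ! t)" by (rule e_pos)
    ultimately show ?thesis using assms by (auto simp: divide_simps)
  qed
  then show ?thesis unfolding pl_val_def by (auto intro!: prod_nonneg prod_le_1)
qed

lemma finite_sample_pmf: "finite (set_pmf sample_pmf)"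
  by (simp add: sample_pmf_def finite_subset_sum_pmf)

lemma sample_pmf_range: "set_pmf sample_pmf \<subseteq> {0..1}"
proof -
  have "0 \<le> pl_val w \<and> pl_val w \<le> 1" if "w \<in> set_pmf (subset_sum_pmf p' e n)" for w
    by (rule pl_val_bounds, rule subset_sum_pmf_nonneg[OF _ that]) (simp add: e_pos less_imp_le)
  then show ?thesis by (auto simp: sample_pmf_def)
qed

lemma prod_set_r: "(\<Prod>i\<in>set r. p i) = q"
proof -
  have "set r = (!) r ` {..<k}" using length_r by (auto simp: set_conv_nth)
  moreover have "inj_on ((!) r) {..<k}" using distinct_r length_r by (simp add: inj_on_nth)
  ultimately show ?thesis by (simp add: q_def prod.reindex)
qed

section \<open>The mean of a sample and the probability of the ranking\<close>

lemma cs_expect_ranked: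
  "cs_expect n p (\<lambda>C. if set r \<subseteq> C then h C else 0) = q * cs_expect n p' (\<lambda>A. h (A \<union> set r))"
  using cs_expect_superset[of "set r" p' p n h] set_r prod_set_r
  by (simp add: p'_def Int_absorb2)

text \<open>After removing the first \<open>t\<close> ranked items, \<open>A\<close> and the rest of
  the ranking remain, and these are disjoint.\<close>

lemma Pr_PL_union:
  assumes "A \<subseteq> {1..n}" "A \<inter> set r = {}"
  shows "Pr_PL u r (A \<union> set r) = pl_val (sum e A)"
proof -
  have "(\<Sum>h\<in>(A \<union> set r) - set (take t r). exp (u h)) = sum e A + (\<Sum>s\<in>{t..<k}. e (r ! s))"
      if "t < k" for t
  proof -
    have r: "set r = set (take t r) \<union> set (drop t r)" "set (take t r) \<inter> set (drop t r) = {}"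
      using distinct_r by (metis append_take_drop_id set_append, metis append_take_drop_id
          distinct_append)
    have "(A \<union> set r) - set (take t r) = A \<union> set (drop t r)"
      using r assms(2) by blast
    moreover have "A \<inter> set (drop t r) = {}" using r assms(2) by blast
    moreover have "finite A" using assms(1) by (rule finite_subset) simp
    moreover have "set (drop t r) = (!) r ` {t..<k}"
      using that length_r by (auto simp: set_conv_nth image_iff) (metis add_diff_inverse_nat leD
          less_diff_conv add.commute)+
    moreover have "inj_on ((!) r) {t..<k}" using distinct_r length_r by (simp add: inj_on_nth)
    ultimately show ?thesis by (simp add: e_def sum.union_disjoint sum.reindex)
  qed
  then show ?thesis
    by (simp add: Pr_PL_def pl_val_def length_r e_def)
qed

definition "\<mu> = measure_pmf.expectation sample_pmf (\<lambda>x. x)"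

lemma \<mu>_eq: "\<mu> = cs_expect n p' (\<lambda>A. Pr_PL u r (A \<union> set r))"
proof -
  have "\<mu> = cs_expect n p' (\<lambda>A. pl_val (sum e A))"
    using expectation_subset_sum_pmf[of n p' e pl_val] p'_bounds by (simp add: \<mu>_def sample_pmf_def)
  also have "\<dots> = cs_expect n p' (\<lambda>A. Pr_PL u r (A \<union> set r))"
    unfolding cs_expect_def
  proof (rule sum.cong[OF refl])
    fix A assume A: "A \<in> Pow {1..n}"
    show "cs_weight n p' A * pl_val (sum e A) = cs_weight n p' A * Pr_PL u r (A \<union> set r)"
    proof (cases "A \<inter> set r = {}")
      case True
      then show ?thesis using Pr_PL_union A by simp
    next
      case False
      moreover have "finite A" using A by (auto intro: finite_subset)
      \<comment> \<open>A set meeting the ranking contains an item with \<open>p'\<close> equal to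
        0, so it has weight 0.\<close>
      ultimately have "(\<Prod>i\<in>A. p' i) = 0" by (auto simp: p'_def)
      then show ?thesis by (simp add: cs_weight_def)
    qed
  qed
  finally show ?thesis .
qed

lemma q_pos: "0 < q"
  unfolding q_def using r_nth p_bounds by (intro prod_pos) auto

text \<open>\<open>q\<close> is the probability that all ranked items are considered, an event
  contained in the size being at least \<open>k\<close>.\<close>

lemma q_le_z: "q \<le> z_kp n k p"
proof -
  have "q = cs_expect n p (\<lambda>C. if set r \<subseteq> C then 1 else 0)"
    by (simp add: cs_expect_ranked cs_expect_1)
  also have "\<dots> \<le> cs_expect n p (\<lambda>C. if k \<le> card C then 1 else 0)"
  proof (rule cs_expect_mono[OF p_nonneg])
    fix C :: "nat set" assume "C \<subseteq> {1..n}"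
    then have "card (set r) \<le> card C" if "set r \<subseteq> C"
      using that by (intro card_mono) (auto intro: finite_subset)
    then show "(if set r \<subseteq> C then 1 else 0) \<le> (if k \<le> card C then 1 else 0 :: real)"
      using distinct_r length_r by (auto simp: distinct_card)
  qed
  finally show ?thesis by (simp add: z_kp_eq_cs_expect)
qed

lemma z_bounds: "0 < z_kp n k p" "z_kp n k p \<le> 1"
proof -
  show "0 < z_kp n k p" using q_pos q_le_z by simp
  have "z_kp n k p \<le> cs_expect n p (\<lambda>_. 1)"
    unfolding z_kp_eq_cs_expect by (rule cs_expect_mono[OF p_nonneg]) auto
  then show "z_kp n k p \<le> 1" by (simp add: cs_expect_1)
qed

lemma Pr_PLC_eq: "Pr_PLC n k u p r = q / z_kp n k p * \<mu>"
proof -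
  have "Pr_C n k p C * Pr_PL u r C = cs_weight n p C *
      (if set r \<subseteq> C then Pr_PL u r C else 0) / z_kp n k p"
    if "C \<in> Pow {1..n}" for C
  proof -
    \<comment> \<open>A set on which \<open>Pr_PL\<close> can be nonzero meets the size condition
      automatically, so the case distinction in \<open>Pr_C\<close> disappears.\<close>
    have "k \<le> card C" if "set r \<subseteq> C"
      using that \<open>C \<in> _\<close> card_mono[of C "set r"] distinct_r length_r
      by (auto simp: distinct_card intro: finite_subset)
    then show ?thesis using that by (auto simp: Pr_C_def Pr_PL_def)
  qed
  then have "Pr_PLC n k u p r = cs_expect n p (\<lambda>C. if set r \<subseteq> C then Pr_PL u r C else 0) / z_kp n
      k p"
    unfolding Pr_PLC_def cs_expect_def sum_divide_distrib by (intro sum.cong refl)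
  then show ?thesis by (simp add: cs_expect_ranked \<mu>_eq)
qed

lemma \<mu>_bounds: "0 \<le> \<mu>" "\<mu> \<le> 1"
proof -
  have int: "integrable sample_pmf f" for f :: "real \<Rightarrow> real"
    by (rule integrable_measure_pmf_finite[OF finite_sample_pmf])
  have AE: "AE x in sample_pmf. 0 \<le> x \<and> x \<le> 1"
    using sample_pmf_range by (auto simp: AE_measure_pmf_iff)
  show "0 \<le> \<mu>" unfolding \<mu>_def by (rule integral_nonneg_AE) (use AE in auto)
  have "\<mu> \<le> measure_pmf.expectation sample_pmf (\<lambda>_. 1)"
    unfolding \<mu>_def by (rule integral_mono_AE[OF int int]) (use AE in auto)
  then show "\<mu> \<le> 1" by simp
qed

lemma Pr_PLC_bounds: "0 \<le> Pr_PLC n k u p r" "Pr_PLC n k u p r \<le> 1"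
proof -
  show "0 \<le> Pr_PLC n k u p r"
    using q_pos z_bounds \<mu>_bounds by (simp add: Pr_PLC_eq)
  have "q / z_kp n k p * \<mu> \<le> 1 * 1"
    using q_pos q_le_z z_bounds \<mu>_bounds by (intro mult_mono) auto
  then show "Pr_PLC n k u p r \<le> 1" by (simp add: Pr_PLC_eq)
qed

lemma Pr_PLC_empty: "k = 0 \<Longrightarrow> Pr_PLC n k u p r = 1"
proof -
  assume k: "k = 0"
  then have "z_kp n k p = 1" by (simp only: z_kp_zero)
  moreover have "q = 1" unfolding q_def using k by simp
  moreover have "Pr_PL u r C = 1" for C using k length_r by (simp add: Pr_PL_def)
  then have "\<mu> = 1" by (simp add: \<mu>_eq cs_expect_1)
  ultimately show ?thesis by (simp add: Pr_PLC_eq)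
qed

text \<open>The assumption makes the Hoeffding failure probability at most \<open>del\<close>.
  Scaling by \<open>q / z \<le> 1\<close> cannot enlarge the deviation, so no factor depending on
  \<open>z\<close> enters the number of samples.\<close>

lemma estimate_accuracy:
  assumes "ln (2 / del) \<le> real m * (2 * eps\<^sup>2)"
  shows "1 - del \<le> measure_pmf.prob (iid_sum_pmf sample_pmf m)
     {x. \<bar>q * x / (z_kp n k p * real m) - Pr_PLC n k u p r\<bar> < eps}"
proof -
  have "0 < ln (2 / del)" using del_pos del_less by simp
  \<comment> \<open>Positivity of \<open>m\<close> makes the division by \<open>m\<close> in the
    estimate meaningful.\<close>
  with assms have m: "0 < m" by (auto intro: Nat.gr0I)
  have "exp (- 2 * real m * eps\<^sup>2) \<le> exp (- ln (2 / del))" using assms by simp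
  also have "\<dots> = del / 2" using del_pos by (simp add: exp_minus)
  finally have "1 - del \<le> 1 - 2 * exp (- 2 * real m * eps\<^sup>2)" by simp
  also have "\<dots> \<le> measure_pmf.prob (iid_sum_pmf sample_pmf m) {s. \<bar>s - real m * \<mu>\<bar> < real m * eps}"
    unfolding \<mu>_def by (rule Hoeffding_iid_sum[OF finite_sample_pmf sample_pmf_range eps_pos])
  also have "\<dots> \<le> measure_pmf.prob (iid_sum_pmf sample_pmf m)
     {x. \<bar>q * x / (z_kp n k p * real m) - Pr_PLC n k u p r\<bar> < eps}"
  proof (rule measure_pmf.finite_measure_mono)
    have "\<bar>q * x / (z_kp n k p * real m) - Pr_PLC n k u p r\<bar> < eps"
        if "\<bar>x - real m * \<mu>\<bar> < real m * eps" for x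
    proof -
      have "q * x / (z_kp n k p * real m) - Pr_PLC n k u p r =
          q / z_kp n k p * ((x - real m * \<mu>) / real m)"
        using m z_bounds by (simp add: Pr_PLC_eq field_simps)
      also have "\<bar>\<dots>\<bar> = q / z_kp n k p * (\<bar>x - real m * \<mu>\<bar> / real m)"
        using m z_bounds q_pos by (simp add: abs_mult)
      also have "\<dots> \<le> 1 * (\<bar>x - real m * \<mu>\<bar> / real m)"
        using m z_bounds q_pos q_le_z by (intro mult_right_mono) auto
      also have "\<dots> < eps" using that m by (simp add: field_simps)
      finally show ?thesis .
    qed
    then show "{s. \<bar>s - real m * \<mu>\<bar> < real m * eps} \<subseteq>
        {x. \<bar>q * x / (z_kp n k p * real m) - Pr_PLC n k u p r\<bar> < eps}" by blast
  qed simp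
  finally show ?thesis .
qed

section \<open>The bound on the running time\<close>

abbreviation "budget \<equiv> 1 + real k * real n * (1 + ln (1 / del)) / (z_kp n k p * eps\<^sup>2)"

text \<open>Since \<open>z * eps\<^sup>2 \<le> 1\<close>, the factor \<open>Y\<close> is at least 1,
  so everything is dominated by a multiple of \<open>k * n * Y\<close>. The summand 1 next to
  \<open>ln (1 / del)\<close> absorbs \<open>ln 2\<close> and keeps \<open>Y\<close> from vanishing
  as \<open>del\<close> tends to 1.\<close>

lemma run_time_le:
  assumes "0 < k" "eps \<le> 1" "real m \<le> ln (2 / del) / (2 * eps\<^sup>2) + 1"
  shows "real (run_time m) \<le> 300 * budget"
proof -
  define Y where "Y = (1 + ln (1 / del)) / (z_kp n k p * eps\<^sup>2)"
  have L: "0 \<le> ln (1 / del)" using del_pos del_less by simp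
  have e2: "0 < eps\<^sup>2" "eps\<^sup>2 \<le> 1" using eps_pos assms(2) by (auto simp: power_le_one)
  have ze: "0 < z_kp n k p * eps\<^sup>2" "z_kp n k p * eps\<^sup>2 \<le> eps\<^sup>2" "z_kp n k p * eps\<^sup>2 \<le> 1"
    using z_bounds e2 by (auto intro: mult_left_le_one_le mult_le_one)
  have Y1: "1 \<le> Y" using ze L by (simp add: Y_def le_divide_eq)
  have "ln (2 / del) = ln 2 + ln (1 / del)" using del_pos by (simp add: ln_div)
  then have "ln (2 / del) \<le> 1 + ln (1 / del)" using ln_2_less_1 by linarith
  then have "ln (2 / del) / (2 * eps\<^sup>2) \<le> Y"
    unfolding Y_def using ze L e2 by (intro frac_le) auto
  then have m: "real m \<le> 2 * Y" using assms(3) Y1 by linarith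
  have n: "1 \<le> real n" "1 \<le> real k" using assms(1) k_le_n by auto
  define a where "a = real k * real n"
  have a: "real k \<le> a" "real n \<le> a" "1 \<le> a"
    using n by (auto simp: a_def mult_le_cancel_left1 mult_le_cancel_right1 intro: mult_ge1_I)
  have "real (run_time m) \<le> 168 + 18 * real k + 20 * real n + 10 * a + real m * (13 * real n +
      12 * real k + 11)"
    by (simp add: run_time_def D_def a_def algebra_simps)
  \<comment> \<open>216 = 168 + 18 + 20 + 10 and 36 = 13 + 12 + 11. With
    \<open>m \<le> 2 * Y\<close> the total is 288, which is below 300.\<close>
  also have "\<dots> \<le> 216 * a + real m * (36 * a)"
    using a by (intro add_mono mult_left_mono) auto
  also have "\<dots> \<le> 216 * a * Y + 2 * Y * (36 * a)"
    using a Y1 m by (intro add_mono mult_right_mono) (auto simp: mult_le_cancel_left1)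
  also have "\<dots> \<le> 300 * (1 + a * Y)"
    using mult_nonneg_nonneg[of a Y] a Y1 by simp
  also have "\<dots> = 300 * budget" by (simp add: a_def Y_def)
  finally show ?thesis .
qed

lemma plc_prog_estimates:
  "1 - del \<le> measure_pmf.prob (run plc_prog (nat \<lfloor>300 * budget\<rfloor>) s0)
     {s. halted plc_prog s \<and> \<bar>out_val s - Pr_PLC n k u p r\<bar> < eps}"
proof -
  have b: "1 \<le> budget"
    using del_pos del_less z_bounds eps_pos by simp
  have "real 19 \<le> 300 * 1" by simp
  also have "\<dots> \<le> 300 * budget" by (rule mult_left_mono[OF b]) simp
  \<comment> \<open>The early exits take 3 and 15 + 4 = 19 steps, which the constant summand of the
    budget covers.\<close>
  finally have T: "19 \<le> nat \<lfloor>300 * budget\<rfloor>" by (rule le_nat_floor)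
  have exact: ?thesis
    if "reaches plc_prog T0 s0 (\<lambda>s. halted plc_prog s \<and> out_val s = v)" "T0 \<le> 19"
        "\<bar>v - Pr_PLC n k u p r\<bar> < eps" for T0 v
  proof -
    have "measure_pmf.prob (return_pmf ()) UNIV \<le> measure_pmf.prob (run plc_prog (nat \<lfloor>300 *
        budget\<rfloor>) s0)
     {s. halted plc_prog s \<and> \<bar>out_val s - Pr_PLC n k u p r\<bar> < eps}"
      by (rule sim_prob_le[OF that(1)]) (use that T in auto)
    then show ?thesis using del_pos by simp
  qed
  consider "1 < eps" | "eps \<le> 1" "k = 0" | "eps \<le> 1" "0 < k" by linarith
  then show ?thesis
  proof cases
    case 1
    then show ?thesis using exact[OF large_eps] Pr_PLC_bounds by simp
  next
    case 2
    have "reaches plc_prog (15 + 4) s0 (\<lambda>s. halted plc_prog s \<and> out_val s = 1)"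
      by (rule sim_after[OF offset_ranking]) (use 2 empty_ranking in auto)
    then show ?thesis using exact[of 19 1] Pr_PLC_empty 2 eps_pos by simp
  next
    case 3
    define x where "x = ln (2 / del) / (2 * eps\<^sup>2)"
    \<comment> \<open>The least count reaching \<open>x\<close>, hence the one at which the program
      stops sampling.\<close>
    define m where "m = nat \<lceil>x\<rceil>"
    have e2: "0 < 2 * eps\<^sup>2" using eps_pos by simp
    have "0 < x" using del_pos del_less eps_pos by (simp add: x_def)
    then have m: "x \<le> real m" "real m \<le> x + 1" and less: "\<And>i. i < m \<Longrightarrow> real i < x"
      unfolding m_def by linarith+
    have Lx: "ln (2 / del) = x * (2 * eps\<^sup>2)" using e2 by (simp add: x_def)
    have m1: "ln (2 / del) \<le> real m * (2 * eps\<^sup>2)" unfolding Lx using m e2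
        by (intro mult_right_mono) auto
    have m2: "real i * (2 * eps\<^sup>2) < ln (2 / del)" if "i < m" for i
      unfolding Lx using less[OF that] e2 by (intro mult_strict_right_mono)
    have "real (run_time m) \<le> 300 * budget"
      by (rule run_time_le) (use 3 m in \<open>simp_all add: x_def\<close>)
    then have time: "run_time m \<le> nat \<lfloor>300 * budget\<rfloor>" by (rule le_nat_floor)
    have "measure_pmf.prob (iid_sum_pmf sample_pmf m)
        {x. \<bar>q * x / (z_kp n k p * real m) - Pr_PLC n k u p r\<bar> < eps} \<le>
       measure_pmf.prob (run plc_prog (nat \<lfloor>300 * budget\<rfloor>) s0)
        {s. halted plc_prog s \<and> \<bar>out_val s - Pr_PLC n k u p r\<bar> < eps}"
      by (rule sim_prob_le[OF plc_prog_correct time]) (use 3 m1 m2 in auto)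
    with estimate_accuracy[OF m1] show ?thesis by linarith
  qed
qed

end

theorem theorem7:
  "\<exists>(P::program) (c::real). c > 0 \<and>
    (\<forall>n k (u::nat \<Rightarrow> real) (p::nat \<Rightarrow> real) (r::nat list) (eps::real) (del::real).
       k \<le> n \<longrightarrow> (\<forall>i\<in>{1..n}. 0 < p i \<and> p i \<le> 1) \<longrightarrow>
       length r = k \<longrightarrow> distinct r \<longrightarrow> set r \<subseteq> {1..n} \<longrightarrow>
       eps > 0 \<longrightarrow> 0 < del \<longrightarrow> del < 1 \<longrightarrow>
       measure_pmf.prob
         (run P (nat \<lfloor>c * (1 + real k * real n * (1 + ln (1 / del)) / (z_kp n k p * eps\<^sup>2))\<rfloor>)
              (init_state n k u p r eps del))
         {s. halted P s \<and> \<bar>out_val s - Pr_PLC n k u p r\<bar> < eps}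
       \<ge> 1 - del)"
proof (intro exI[of _ plc_prog] exI[of _ "300 :: real"] conjI allI impI)
  fix n k :: nat and u p :: "nat \<Rightarrow> real" and r :: "nat list" and eps del :: real
  assume "k \<le> n" "\<forall>i\<in>{1..n}. 0 < p i \<and> p i \<le> 1" "length r = k" "distinct r" "set r \<subseteq> {1..n}"
    "eps > 0" "0 < del" "del < 1"
  then interpret plc_input n k u p r eps del
    by unfold_locales auto
  show "measure_pmf.prob
         (run plc_prog (nat \<lfloor>300 * (1 + real k * real n * (1 +
             ln (1 / del)) / (z_kp n k p * eps\<^sup>2))\<rfloor>)
              (init_state n k u p r eps del))
         {s. halted plc_prog s \<and> \<bar>out_val s - Pr_PLC n k u p r\<bar> < eps}
       \<ge> 1 - del"
    by (rule plc_prog_estimates)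
qed simp
end
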